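(* Let $\mathcal{X}\subseteq\mathbb{Z}^n$ be a discrete hyperrectangle, $N=\{1,\dots,n\}$, $h^i:\mathcal{X}\to\mathbb{R}$ for $i\in N$, and $\mathcal{P}^H=\{(w,\mathbf{y},\mathbf{x})\in\mathbb{R}\times\mathbb{R}^n_+\times\mathcal{X}:w\ge h^i(\mathbf{x})-y_i\ \forall i\in N\}$. Assume that $h^j$ and $g^j_i(\mathbf{x})=\max\{0,h^i(\mathbf{x})-h^j(\mathbf{x})\}$ are L$^\natural$-convex for all $i,j\in N$, and that $F_{u_0,\mathbf{u}}$ is L$^\natural$-convex for all $(u_0,\mathbf{u})\in\mathcal{U}$. Let $$\mathcal{CP}'=\{(w,\mathbf{y},\mathbf{x})\in\mathbb{R}\times\mathbb{R}^n_+\times\overline{\mathcal{X}}:(w+\mathbf{u}^\top\mathbf{y},\mathbf{x})\in\operatorname{conv}(\mathcal{P}^{F_{1,\mathbf{u}}})\ \forall\mathbf{u}\in\mathcal{U}'\}.$$ Then $\operatorname{conv}(\mathcal{P}^H)=\mathcal{CP}'$.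
   Context: A discrete hyperrectangle is $\mathcal{X}=\{\mathbf{x}\in\mathbb{Z}^n:a_i\le x_i\le b_i\ \forall i\in N\}$ with $a_i\in\mathbb{Z}\cup\{-\infty\}$, $b_i\in\mathbb{Z}\cup\{+\infty\}$; $\overline{\mathcal{X}}\subseteq\mathbb{R}^n$ is its continuous relaxation. $f:\mathcal{X}\to\mathbb{R}$ is L$^\natural$-convex if $f(\mathbf{x})+f(\mathbf{y})\ge f(\lceil(\mathbf{x}+\mathbf{y})/2\rceil)+f(\lfloor(\mathbf{x}+\mathbf{y})/2\rfloor)$ for all $\mathbf{x},\mathbf{y}\in\mathcal{X}$ (component-wise rounding). $\mathcal{U}=\{(u_0,\mathbf{u})\in\mathbb{R}^{n+1}_+:u_0\le\sum_{i\in N}u_i\}$; $F_{u_0,\mathbf{u}}(\mathbf{x})=\min_{j\in N}\{u_0h^j(\mathbf{x})+\sum_{i\in N}u_ig^j_i(\mathbf{x})\}$ for $\mathbf{x}\in\mathcal{X}$; $\mathcal{P}^F=\{(\eta,\mathbf{x})\in\mathbb{R}\times\mathcal{X}:\eta\ge F(\mathbf{x})\}$. $\mathcal{U}'$ is the finite set of all $\mathbf{u}\in\mathbb{R}^n_+$ for which there exist a nonempty $M\subseteq N$ and a binary matrix $B\in\{0,1\}^{|M|\times|M|}$, invertible over $\mathbb{R}$, such that $\mathbf{u}^M=B^{-1}\mathbf{1}$ and $\mathbf{u}^{N\setminus M}=\mathbf{0}$, where $\mathbf{u}^M=[u_i]_{i\in M}$ and $\mathbf{1}$ is the all-ones vector.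 (Every $\mathbf{u}\in\mathcal{U}'$ satisfies $(1,\mathbf{u})\in\mathcal{U}$.) *)

theory Defs
  imports "HOL-Analysis.Analysis" "Jordan_Normal_Form.Matrix"
begin

no_notation Matrix.vec_index (infixl "$" 100)
no_notation Matrix.scalar_prod (infix "\<bullet>" 70)

text \<open>
  The index set \<open>N\<close> is the type \<open>'n\<close>, so \<open>n \<ge> 1\<close>. Functions on \<open>\<X>\<close> are total functions on
  \<open>real ^ 'n\<close> of which only the values on \<open>\<X>\<close> are ever used.
\<close>

definition integer_bounds :: "('n \<Rightarrow> ereal) \<Rightarrow> ('n \<Rightarrow> ereal) \<Rightarrow> bool" where
  "integer_bounds a b \<longleftrightarrow>
     (\<forall>i. a i = -\<infinity> \<or> (\<exists>k::int. a i = ereal (of_int k))) \<and>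
     (\<forall>i. b i = \<infinity> \<or> (\<exists>k::int. b i = ereal (of_int k)))"

definition relaxed_box :: "('n::finite \<Rightarrow> ereal) \<Rightarrow> ('n \<Rightarrow> ereal) \<Rightarrow> (real ^ 'n) set" where
  "relaxed_box a b = {x. \<forall>i. a i \<le> ereal (x $ i) \<and> ereal (x $ i) \<le> b i}"

definition discrete_box :: "('n::finite \<Rightarrow> ereal) \<Rightarrow> ('n \<Rightarrow> ereal) \<Rightarrow> (real ^ 'n) set" where
  "discrete_box a b =
     {x. \<forall>i. x $ i \<in> \<int> \<and> a i \<le> ereal (x $ i) \<and> ereal (x $ i) \<le> b i}"

definition ceil_vec :: "real ^ 'n \<Rightarrow> real ^ 'n" where
  "ceil_vec x = (\<chi> i. of_int \<lceil>x $ i\<rceil>)"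

definition floor_vec :: "real ^ 'n \<Rightarrow> real ^ 'n" where
  "floor_vec x = (\<chi> i. of_int \<lfloor>x $ i\<rfloor>)"

definition L_natural_convex_on :: "(real ^ 'n) set \<Rightarrow> (real ^ 'n \<Rightarrow> real) \<Rightarrow> bool" where
  "L_natural_convex_on X f \<longleftrightarrow>
     (\<forall>x\<in>X. \<forall>y\<in>X. f x + f y \<ge>
        f (ceil_vec ((1/2) *\<^sub>R (x + y))) + f (floor_vec ((1/2) *\<^sub>R (x + y))))"

definition epigraph_on :: "(real ^ 'n) set \<Rightarrow> (real ^ 'n \<Rightarrow> real) \<Rightarrow> (real \<times> (real ^ 'n)) set" where
  "epigraph_on X f = {(\<eta>, x). x \<in> X \<and> \<eta> \<ge> f x}"

definition U_cone :: "(real \<times> (real ^ 'n::finite)) set" where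
  "U_cone = {(u0, u). 0 \<le> u0 \<and> (\<forall>i. 0 \<le> u $ i) \<and> u0 \<le> (\<Sum>i\<in>UNIV. u $ i)}"

text \<open>\<open>gap h j i\<close> is \<open>g\<^sup>j\<^sub>i\<close>: the superscript comes first.\<close>

definition gap :: "('n \<Rightarrow> real ^ 'n \<Rightarrow> real) \<Rightarrow> 'n \<Rightarrow> 'n \<Rightarrow> real ^ 'n \<Rightarrow> real" where
  "gap h j i x = max 0 (h i x - h j x)"

definition F_agg :: "('n::finite \<Rightarrow> real ^ 'n \<Rightarrow> real) \<Rightarrow> real \<Rightarrow> real ^ 'n \<Rightarrow> real ^ 'n \<Rightarrow> real" where
  "F_agg h u0 u x = (MIN j\<in>UNIV. u0 * h j x + (\<Sum>i\<in>UNIV. u $ i * gap h j i x))"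

definition P_H ::
  "(real ^ 'n) set \<Rightarrow> ('n \<Rightarrow> real ^ 'n \<Rightarrow> real) \<Rightarrow> (real \<times> (real ^ 'n) \<times> (real ^ 'n)) set" where
  "P_H X h = {(w, y, x). (\<forall>i. 0 \<le> y $ i) \<and> x \<in> X \<and> (\<forall>i. w \<ge> h i x - y $ i)}"

text \<open>
  The bijection \<open>e\<close> lists \<open>M\<close>, so that \<open>Matrix.vec (card M) (\<lambda>k. u $ e k)\<close> is \<open>u\<^sup>M\<close>; since
  permuting the columns of \<open>B\<close> keeps it binary and invertible, the choice of the listing is
  immaterial. \<open>C\<close> is \<open>B\<^sup>-\<^sup>1\<close>.
\<close>

definition U_fin :: "(real ^ 'n::finite) set" where
  "U_fin = {u. (\<forall>i. 0 \<le> u $ i) \<and>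
     (\<exists>M e. \<exists>B C :: real mat.
        M \<noteq> {} \<and> bij_betw e {..<card M} M \<and>
        B \<in> carrier_mat (card M) (card M) \<and> C \<in> carrier_mat (card M) (card M) \<and>
        elements_mat B \<subseteq> {0, 1} \<and>
        inverts_mat B C \<and> inverts_mat C B \<and>
        Matrix.vec (card M) (\<lambda>k. u $ e k) = C *\<^sub>v Matrix.vec (card M) (\<lambda>_. 1) \<and>
        (\<forall>i. i \<notin> M \<longrightarrow> u $ i = 0))}"

definition CP_fin ::
  "('n::finite \<Rightarrow> ereal) \<Rightarrow> ('n \<Rightarrow> ereal) \<Rightarrow> ('n \<Rightarrow> real ^ 'n \<Rightarrow> real)
     \<Rightarrow> (real \<times> (real ^ 'n) \<times> (real ^ 'n)) set" where
  "CP_fin a b h = {(w, y, x). (\<forall>i. 0 \<le> y $ i) \<and> x \<in> relaxed_box a b \<and>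
     (\<forall>u\<in>U_fin. (w + u \<bullet> y, x) \<in> convex hull (epigraph_on (discrete_box a b) (F_agg h 1 u)))}"

end

theory Submission
  imports Defs "Jordan_Normal_Form.Determinant"
begin

text \<open>
  A point \<open>x\<close> of the relaxed box lies in a unit cube, where sorting its fractional parts writes it as a
  convex combination \<open>\<Sum> \<mu>\<^sub>k v\<^sub>k\<close> of a chain of integer points. The same weights and chain
  compute the convex closure at \<open>x\<close> of every \<open>L\<close>-natural-convex function, because the affine function
  interpolating \<open>f\<close> on the chain minorizes \<open>f\<close>. Hence the constraints of \<open>\<C>\<P>'\<close> read
  \<open>\<Sum> \<mu>\<^sub>k F\<^bsub>1,u\<^esub>(v\<^sub>k) \<le> w + u\<^sup>T y\<close>. By separation, \<open>(w, y, x)\<close> is in \<open>conv(P\<^sup>H)\<close> as soon as this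
  holds for all \<open>u \<ge> 0\<close> with \<open>\<Sum> u\<^sub>i \<ge> 1\<close>. The minimum in \<open>F\<^bsub>1,u\<^esub>(v)\<close> is attained at a
  \<open>u\<close>-weighted median of the \<open>h\<^sup>i(v)\<close>, so \<open>F\<^bsub>1,u\<^esub>\<close> is linear in \<open>u\<close> on the cells of the
  arrangement of the hyperplanes \<open>u(S) = 1\<close>, and the vertices of these cells form \<open>\<U>'\<close>.
\<close>

no_notation Matrix.vec_index (infixl "$" 100)
no_notation Matrix.scalar_prod (infix "\<bullet>" 70)

section \<open>Indicator vectors and rounded midpoints in a discrete box\<close>

definition indicator_vec :: "'n set \<Rightarrow> real ^ 'n" where
  "indicator_vec S = (\<chi> i. if i \<in> S then 1 else 0)"

lemma indicator_vec_nth [simp]: "indicator_vec S $ i = (if i \<in> S then 1 else 0)"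
  by (simp add: indicator_vec_def)

lemma indicator_vec_empty [simp]: "indicator_vec {} = 0"
  by (simp add: Finite_Cartesian_Product.vec_eq_iff)

lemma indicator_vec_insert: "i \<notin> S \<Longrightarrow> indicator_vec (insert i S) = indicator_vec S + axis i 1"
  by (auto simp: Finite_Cartesian_Product.vec_eq_iff axis_def)

lemma inner_indicator_vec:
  fixes u :: "real ^ 'n::finite"
  shows "u \<bullet> indicator_vec S = (\<Sum>i\<in>S. u $ i)"
  by (simp add: inner_vec_def if_distrib [of "\<lambda>t. _ * t"] sum.If_cases cong: if_cong)

text \<open>Rounding cannot push a midpoint past a bound that is an integer or infinite.
  \<open>L_natural_convex_on\<close> does not demand that rounded midpoints stay in the set, so this
  is what allows its inequality to be iterated.\<close>

lemma discrete_box_midpoint: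
  assumes "integer_bounds a b" "x \<in> discrete_box a b" "y \<in> discrete_box a b"
  shows "ceil_vec ((1/2) *\<^sub>R (x + y)) \<in> discrete_box a b"
    and "floor_vec ((1/2) *\<^sub>R (x + y)) \<in> discrete_box a b"
proof -
  have *: "a i \<le> ereal (of_int \<lfloor>(x $ i + y $ i) / 2\<rfloor>) \<and> ereal (of_int \<lceil>(x $ i + y $ i) / 2\<rceil>) \<le> b i
    \<and> a i \<le> ereal (of_int \<lceil>(x $ i + y $ i) / 2\<rceil>) \<and> ereal (of_int \<lfloor>(x $ i + y $ i) / 2\<rfloor>) \<le> b i" for i
  proof -
    have ab: "a i = -\<infinity> \<or> (\<exists>k::int. a i = ereal (of_int k))" "b i = \<infinity> \<or> (\<exists>k::int. b i = ereal (of_int k))"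
      using assms(1) by (auto simp: integer_bounds_def)
    have xy: "a i \<le> ereal (x $ i)" "ereal (x $ i) \<le> b i" "a i \<le> ereal (y $ i)" "ereal (y $ i) \<le> b i"
      using assms(2,3) by (auto simp: discrete_box_def)
    have lo: "a i \<le> ereal (of_int \<lfloor>(x $ i + y $ i) / 2\<rfloor>)"
      using ab(1)
    proof
      assume "\<exists>k::int. a i = ereal (of_int k)"
      then obtain k :: int where k: "a i = ereal (of_int k)" by blast
      with xy have "of_int k \<le> (x $ i + y $ i) / 2" by simp
      then show ?thesis by (simp add: k le_floor_iff)
    qed simp
    have hi: "ereal (of_int \<lceil>(x $ i + y $ i) / 2\<rceil>) \<le> b i"
      using ab(2)
    proof
      assume "\<exists>k::int. b i = ereal (of_int k)"
      then obtain k :: int where k: "b i = ereal (of_int k)" by blast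
      with xy have "(x $ i + y $ i) / 2 \<le> of_int k" by simp
      then show ?thesis by (simp add: k ceiling_le_iff)
    qed simp
    have "ereal (of_int \<lfloor>(x $ i + y $ i) / 2\<rfloor>) \<le> ereal (of_int \<lceil>(x $ i + y $ i) / 2\<rceil>)"
      by simp
    with lo hi show ?thesis by (meson order_trans)
  qed
  show "ceil_vec ((1/2) *\<^sub>R (x + y)) \<in> discrete_box a b"
       "floor_vec ((1/2) *\<^sub>R (x + y)) \<in> discrete_box a b"
    using * by (auto simp: discrete_box_def ceil_vec_def floor_vec_def)
qed

lemma ceil_floor_half_Ints:
  fixes s :: real
  assumes "s \<in> \<int>"
  shows "of_int \<lceil>s / 2\<rceil> + of_int \<lfloor>s / 2\<rfloor> = s"
proof -
  obtain k where k: "s = of_int k" using assms by (auto elim: Ints_cases)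
  have "\<lceil>s / 2\<rceil> + \<lfloor>s / 2\<rfloor> = k"
    unfolding k by linarith
  then show ?thesis unfolding k by (metis of_int_add)
qed

text \<open>Affine functions therefore satisfy the L-natural inequality with equality, and
  subtracting one keeps a function L-natural-convex.\<close>

lemma ceil_vec_add_floor_vec:
  assumes "x \<in> discrete_box a b" "y \<in> discrete_box a b"
  shows "ceil_vec ((1/2) *\<^sub>R (x + y)) + floor_vec ((1/2) *\<^sub>R (x + y)) = x + y"
proof -
  have "x $ i + y $ i \<in> \<int>" for i
    using assms by (auto simp: discrete_box_def)
  then show ?thesis
    by (simp add: Finite_Cartesian_Product.vec_eq_iff ceil_vec_def floor_vec_def ceil_floor_half_Ints)
qed

text \<open>On the vertices of a unit cube, the L-natural inequality for \<open>f\<close> is thus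
  submodularity of the set function that sends \<open>S\<close> to
  \<open>f (c + indicator_vec S)\<close>.\<close>

lemma midpoint_indicator:
  fixes c :: "real ^ 'n"
  assumes "\<And>i. c $ i \<in> \<int>"
  shows "ceil_vec ((1/2) *\<^sub>R ((c + indicator_vec S) + (c + indicator_vec T))) = c + indicator_vec (S \<union> T)"
    and "floor_vec ((1/2) *\<^sub>R ((c + indicator_vec S) + (c + indicator_vec T))) = c + indicator_vec (S \<inter> T)"
proof -
  have *: "of_int \<lceil>(c $ i + indicator_vec S $ i + (c $ i + indicator_vec T $ i)) / 2\<rceil> = c $ i + indicator_vec (S \<union> T) $ i
     \<and> of_int \<lfloor>(c $ i + indicator_vec S $ i + (c $ i + indicator_vec T $ i)) / 2\<rfloor> = c $ i + indicator_vec (S \<inter> T) $ i" for i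
  proof -
    obtain k where k: "c $ i = of_int k" using assms[of i] by (auto elim: Ints_cases)
    have "\<lceil>(c $ i + indicator_vec S $ i + (c $ i + indicator_vec T $ i)) / 2\<rceil> = (if i \<in> S \<union> T then k + 1 else k)"
         "\<lfloor>(c $ i + indicator_vec S $ i + (c $ i + indicator_vec T $ i)) / 2\<rfloor> = (if i \<in> S \<inter> T then k + 1 else k)"
      unfolding k by (auto intro!: ceiling_unique floor_unique)
    then show ?thesis unfolding k by simp
  qed
  show "ceil_vec ((1/2) *\<^sub>R ((c + indicator_vec S) + (c + indicator_vec T))) = c + indicator_vec (S \<union> T)"
       "floor_vec ((1/2) *\<^sub>R ((c + indicator_vec S) + (c + indicator_vec T))) = c + indicator_vec (S \<inter> T)"
    using * by (auto simp: ceil_vec_def floor_vec_def Finite_Cartesian_Product.vec_eq_iff simp del: indicator_vec_nth)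
qed

section \<open>Chains in a unit cube and the convex closure of L-natural-convex functions\<close>

text \<open>
  Inside the cube, uncrossing a set with the first chain member it does not contain adds one element.
  Outside, the midpoints of \<open>z\<close> and \<open>c\<close> are closer to \<open>c\<close> until \<open>z - c\<close> has entries in \<open>{-1, 0, 1}\<close>;
  then the midpoints of \<open>z\<close> and the top of the cube lie in the cube.
\<close>

lemma nonneg_of_chain_zero:
  fixes c :: "real ^ 'n::finite"
  assumes ab: "integer_bounds a b"
    and g: "L_natural_convex_on (discrete_box a b) g"
    and cube: "\<And>S. S \<subseteq> set js \<Longrightarrow> c + indicator_vec S \<in> discrete_box a b"
    and flat: "\<And>z i. z \<in> discrete_box a b \<Longrightarrow> i \<notin> set js \<Longrightarrow> z $ i = c $ i"
    and zero: "\<And>k. k \<le> length js \<Longrightarrow> g (c + indicator_vec (set (take k js))) = 0"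
    and z: "z \<in> discrete_box a b"
  shows "g z \<ge> 0"
proof -
  let ?X = "discrete_box a b"
  have c: "c \<in> ?X" using cube[of "{}"] by simp
  then have cint: "c $ i \<in> \<int>" for i by (simp add: discrete_box_def)
  have uncross: "g (ceil_vec ((1/2) *\<^sub>R (x + y))) + g (floor_vec ((1/2) *\<^sub>R (x + y))) \<le> g x + g y"
    if "x \<in> ?X" "y \<in> ?X" for x y
    using g that by (auto simp: L_natural_convex_on_def)
  have in_cube: "g (c + indicator_vec S) \<ge> 0" if "S \<subseteq> set js" for S
    using that
  proof (induction "card (set js - S)" arbitrary: S rule: less_induct)
    case less
    show ?case
    proof (cases "S = set js")
      case True
      then show ?thesis using zero[of "length js"] by simp
    next
      case False
      with less.prems have ex: "\<exists>k. k < length js \<and> js ! k \<notin> S"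
        by (metis in_set_conv_nth subset_antisym subsetI)
      define k where "k = (LEAST k. k < length js \<and> js ! k \<notin> S)"
      have k: "k < length js" "js ! k \<notin> S"
        using LeastI_ex[OF ex] by (auto simp: k_def)
      have before: "js ! l \<in> S" if "l < k" for l
        using not_less_Least[of l "\<lambda>k. k < length js \<and> js ! k \<notin> S"] that k(1) by (auto simp: k_def)
      have tk: "set (take k js) \<subseteq> S"
        using before k(1) by (auto simp: in_set_conv_nth)
      let ?T = "set (take (Suc k) js)"
      have T: "?T = insert (js ! k) (set (take k js))"
        using k(1) by (simp add: take_Suc_conv_app_nth)
      have un: "S \<union> ?T = insert (js ! k) S" and int: "S \<inter> ?T = set (take k js)"
        using T tk k(2) by auto
      have Tsub: "?T \<subseteq> set js" by (rule set_take_subset)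
      \<comment> \<open>\<open>set (take k js)\<close> and \<open>?T\<close> belong to the chain,
        where \<open>g\<close> vanishes, so the value at the enlarged set is a lower bound for the
        value at \<open>S\<close>.\<close>
      have "g (c + indicator_vec (insert (js ! k) S)) + g (c + indicator_vec (set (take k js)))
        \<le> g (c + indicator_vec S) + g (c + indicator_vec ?T)"
        using uncross[OF cube[OF less.prems] cube[OF Tsub]]
        unfolding midpoint_indicator[OF cint] un int .
      moreover have "g (c + indicator_vec (insert (js ! k) S)) \<ge> 0"
      proof (rule less.hyps)
        show "insert (js ! k) S \<subseteq> set js" using k less.prems by auto
        show "card (set js - insert (js ! k) S) < card (set js - S)"
          by (rule psubset_card_mono) (use k nth_mem[OF k(1)] in blast)+
      qed
      ultimately show ?thesis using zero[of k] zero[of "Suc k"] k(1) by simp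
    qed
  qed
  have step: "g z \<ge> 0" if "z \<in> ?X" "\<And>i. \<bar>z $ i - c $ i\<bar> \<le> real m" for z m
    using that
  proof (induction m arbitrary: z rule: less_induct)
    case (less m)
    define Z where "Z i = \<lfloor>z $ i\<rfloor>" for i
    define C where "C i = \<lfloor>c $ i\<rfloor>" for i
    have Z: "z $ i = of_int (Z i)" and C: "c $ i = of_int (C i)" for i
      using less.prems(1) cint[of i] by (auto simp: Z_def C_def discrete_box_def elim!: Ints_cases)
    have d: "\<bar>Z i - C i\<bar> \<le> int m" for i
      using less.prems(2)[of i] unfolding Z C by linarith
    show ?case
    proof (cases "m \<le> 1")
      case True
      let ?t = "c + indicator_vec (set js)"
      have t: "?t \<in> ?X" using cube by blast
      have out: "Z i = C i" if "i \<notin> set js" for i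
        using flat[OF less.prems(1) that] unfolding Z C by simp
      have dd: "Z i \<in> {C i - 1, C i, C i + 1}" for i
        using d[of i] True by auto
      \<comment> \<open>On \<open>set js\<close> the entries of the midpoint minus \<open>c\<close>
        are 0, 1/2 or 1: rounding up gives 1 when \<open>Z i \<ge> C i\<close>, rounding down only
        when \<open>Z i > C i\<close>. Elsewhere \<open>z\<close> and \<open>?t\<close> agree with
        \<open>c\<close>.\<close>
      have "of_int \<lceil>(z $ i + (c $ i + indicator_vec (set js) $ i)) / 2\<rceil>
          = c $ i + indicator_vec {i \<in> set js. Z i \<ge> C i} $ i" for i
      proof -
        have "\<lceil>(z $ i + (c $ i + indicator_vec (set js) $ i)) / 2\<rceil> =
          (if i \<in> set js \<and> Z i \<ge> C i then C i + 1 else C i)"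
          using dd[of i] out[of i] unfolding Z C by (auto intro!: ceiling_unique)
        then show ?thesis unfolding C by simp
      qed
      then have ce: "ceil_vec ((1/2) *\<^sub>R (z + ?t)) = c + indicator_vec {i \<in> set js. Z i \<ge> C i}"
        unfolding ceil_vec_def Finite_Cartesian_Product.vec_eq_iff by simp
      have "of_int \<lfloor>(z $ i + (c $ i + indicator_vec (set js) $ i)) / 2\<rfloor>
          = c $ i + indicator_vec {i \<in> set js. Z i > C i} $ i" for i
      proof -
        have "\<lfloor>(z $ i + (c $ i + indicator_vec (set js) $ i)) / 2\<rfloor> =
          (if i \<in> set js \<and> Z i > C i then C i + 1 else C i)"
          using dd[of i] out[of i] unfolding Z C by (auto intro!: floor_unique)
        then show ?thesis unfolding C by simp
      qed
      then have fl: "floor_vec ((1/2) *\<^sub>R (z + ?t)) = c + indicator_vec {i \<in> set js. Z i > C i}"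
        unfolding floor_vec_def Finite_Cartesian_Product.vec_eq_iff by simp
      show ?thesis
        using uncross[OF less.prems(1) t] zero[of "length js"]
          in_cube[of "{i \<in> set js. Z i \<ge> C i}"] in_cube[of "{i \<in> set js. Z i > C i}"]
        unfolding ce fl by auto
    next
      case False
      have m: "m - 1 < m" using False by simp
      \<comment> \<open>Half of a difference of size at most \<open>m\<close> rounds to at most the
        ceiling of \<open>m / 2\<close>, which is at most \<open>m - 1\<close> because
        \<open>m \<ge> 2\<close>; at \<open>m = 1\<close> there is no progress, hence the separate
        case above.\<close>
      have "\<bar>\<lceil>(z $ i + c $ i) / 2\<rceil> - C i\<bar> \<le> int (m - 1) \<and> \<bar>\<lfloor>(z $ i + c $ i) / 2\<rfloor> - C i\<bar> \<le> int (m - 1)" for i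
      proof -
        let ?p = "\<lceil>(z $ i + c $ i) / 2\<rceil>" and ?q = "\<lfloor>(z $ i + c $ i) / 2\<rfloor>"
        have "Z i + C i \<le> 2 * ?p" "2 * ?p \<le> Z i + C i + 1"
          "2 * ?q \<le> Z i + C i" "Z i + C i \<le> 2 * ?q + 1"
          using floor_divide_of_int_eq[of "Z i + C i" 2, where 'a = real]
            ceiling_divide_eq_div[of "Z i + C i" 2, where 'a = real] unfolding Z C by simp_all
        moreover have "int (m - 1) = int m - 1" "int m \<ge> 2" using False by auto
        ultimately show ?thesis using d[of i] by linarith
      qed
      then have near: "\<bar>of_int \<lceil>(z $ i + c $ i) / 2\<rceil> - c $ i\<bar> \<le> real (m - 1)
          \<and> \<bar>of_int \<lfloor>(z $ i + c $ i) / 2\<rfloor> - c $ i\<bar> \<le> real (m - 1)" for i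
        unfolding C by (metis of_int_abs of_int_diff of_int_le_iff of_int_of_nat_eq)
      have "g (ceil_vec ((1/2) *\<^sub>R (z + c))) \<ge> 0" "g (floor_vec ((1/2) *\<^sub>R (z + c))) \<ge> 0"
        using near by (intro less.IH[OF m] discrete_box_midpoint[OF ab less.prems(1) c];
            simp add: ceil_vec_def floor_vec_def)+
      then show ?thesis
        using uncross[OF less.prems(1) c] zero[of 0] by simp
    qed
  qed
  show ?thesis
  proof (rule step[OF z, of "nat \<lceil>norm (z - c)\<rceil>"])
    fix i
    have "\<bar>z $ i - c $ i\<bar> \<le> norm (z - c)"
      using component_le_norm_cart[of "z - c" i] by simp
    then show "\<bar>z $ i - c $ i\<bar> \<le> real (nat \<lceil>norm (z - c)\<rceil>)" by linarith
  qed
qed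

text \<open>Abel summation; the weights of the chain will be differences of consecutive sorted
  fractional parts.\<close>

lemma sum_by_parts:
  fixes G :: "nat \<Rightarrow> 'a::real_vector"
  shows "(\<Sum>k\<le>m. (\<tau> k - \<tau> (Suc k)) *\<^sub>R G k)
    = \<tau> 0 *\<^sub>R G 0 + (\<Sum>k<m. \<tau> (Suc k) *\<^sub>R (G (Suc k) - G k)) - \<tau> (Suc m) *\<^sub>R G m"
  by (induction m) (simp_all add: algebra_simps)

text \<open>The order of the quantifiers matters: \<open>v\<close> and \<open>\<mu>\<close> depend
  on \<open>x\<close> alone, so a single chain serves \<open>F_agg h 1 u\<close> for all
  \<open>u\<close> at once. The weighted sum of values is the Lovasz extension of \<open>f\<close>
  on the cube.\<close>

lemma common_chain:
  fixes a b :: "'n::finite \<Rightarrow> ereal" and x :: "real ^ 'n"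
  assumes ab: "integer_bounds a b" and x: "x \<in> relaxed_box a b"
  obtains m :: nat and v \<mu> where
    "\<And>k. k \<le> m \<Longrightarrow> v k \<in> discrete_box a b" "\<And>k. k \<le> m \<Longrightarrow> 0 \<le> \<mu> k"
    "(\<Sum>k\<le>m. \<mu> k) = 1" "(\<Sum>k\<le>m. \<mu> k *\<^sub>R v k) = x"
    "\<And>f \<eta>. L_natural_convex_on (discrete_box a b) f \<Longrightarrow>
      (\<eta>, x) \<in> convex hull (epigraph_on (discrete_box a b) f) \<Longrightarrow> (\<Sum>k\<le>m. \<mu> k * f (v k)) \<le> \<eta>"
proof -
  let ?X = "discrete_box a b"
  \<comment> \<open>The coordinates in which the box has room for an edge of length one; the cube is
    flat in all others.\<close>
  define J where "J = {i. a i < b i}"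
  have "\<exists>c::int. a i \<le> ereal c \<and> ereal c \<le> b i \<and> c \<le> x $ i \<and> x $ i \<le> c + 1
     \<and> (i \<in> J \<longrightarrow> ereal (c + 1) \<le> b i) \<and> (i \<notin> J \<longrightarrow> a i = ereal c \<and> b i = ereal c)" for i
  proof -
    have A: "a i = -\<infinity> \<or> (\<exists>k::int. a i = ereal (of_int k))" and B: "b i = \<infinity> \<or> (\<exists>k::int. b i = ereal (of_int k))"
      using ab by (auto simp: integer_bounds_def)
    have X: "a i \<le> ereal (x $ i)" "ereal (x $ i) \<le> b i"
      using x by (auto simp: relaxed_box_def)
    have lo: "a i \<le> ereal (of_int \<lfloor>x $ i\<rfloor>)"
      using A X(1) by (auto simp: le_floor_iff)
    show ?thesis
    proof (cases "ereal (of_int \<lfloor>x $ i\<rfloor> + 1) \<le> b i")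
      case True
      then have "i \<in> J" using lo unfolding J_def by (cases "a i"; cases "b i") auto
      moreover have "ereal (of_int \<lfloor>x $ i\<rfloor>) \<le> b i"
        using True by (cases "b i") auto
      ultimately show ?thesis using lo True
        by (intro exI[of _ "\<lfloor>x $ i\<rfloor>"]) (simp; linarith)
    next
      \<comment> \<open>Here \<open>x $ i\<close> sits on the upper bound, so for
        \<open>i \<in> J\<close> the edge is placed below it and the fractional part becomes 1
        instead of 0.\<close>
      case False
      then obtain k :: int where k: "b i = ereal (of_int k)" using B by auto
      have "\<not> \<lfloor>x $ i\<rfloor> + 1 \<le> k" using False unfolding k by simp
      moreover have "x $ i \<le> of_int k" using X(2) unfolding k by simp
      ultimately have xk: "x $ i = of_int k" by linarith
      show ?thesis
      proof (cases "i \<in> J")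
        case True
        then have "a i \<le> ereal (of_int (k - 1))"
          using A by (auto simp: J_def k)
        then show ?thesis using True by (intro exI[of _ "k - 1"]) (simp add: k xk)
      next
        case False
        then have "a i = ereal (of_int k)" using X by (auto simp: J_def k xk)
        then show ?thesis using False by (intro exI[of _ k]) (simp add: k xk)
      qed
    qed
  qed
  then obtain C :: "'n \<Rightarrow> int" where C: "\<And>i. a i \<le> ereal (of_int (C i))" "\<And>i. ereal (of_int (C i)) \<le> b i"
    "\<And>i. of_int (C i) \<le> x $ i" "\<And>i. x $ i \<le> of_int (C i) + 1" "\<And>i. i \<in> J \<Longrightarrow> ereal (of_int (C i) + 1) \<le> b i"
    "\<And>i. i \<notin> J \<Longrightarrow> a i = ereal (of_int (C i)) \<and> b i = ereal (of_int (C i))"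
    by metis
  define c :: "real ^ 'n" where "c = (\<chi> i. of_int (C i))"
  define t where "t i = x $ i - c $ i" for i
  have t01: "0 \<le> t i" "t i \<le> 1" for i
    using C(3,4)[of i] by (auto simp: t_def c_def)
  have tJ: "t i = 0" if "i \<notin> J" for i
    using x C(6)[OF that] by (auto simp: t_def c_def relaxed_box_def intro!: antisym dest!: spec[of _ i])
  obtain js0 where js0: "set js0 = J" "distinct js0"
    using finite_distinct_list[of J] by auto
  \<comment> \<open>The negated key makes the chain add coordinates by decreasing fractional
    part.\<close>
  define js where "js = sort_key (\<lambda>i. - t i) js0"
  have js: "set js = J" "distinct js" "sorted (map (\<lambda>i. - t i) js)"
    using js0 by (auto simp: js_def)
  define m where "m = length js"
  define v where "v k = c + indicator_vec (set (take k js))" for k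
  \<comment> \<open>The sorted fractional parts, shifted by one position, between the sentinels 1 at
    index 0 and 0 beyond \<open>m\<close>; their successive differences are nonnegative and
    telescope to 1.\<close>
  define \<tau> where "\<tau> k = (if k = 0 then 1 else if k \<le> m then t (js ! (k - 1)) else 0)" for k
  define \<mu> where "\<mu> k = \<tau> k - \<tau> (Suc k)" for k
  have step: "v (Suc k) - v k = axis (js ! k) 1" if "k < m" for k
  proof -
    have "js ! k \<notin> set (take k js)"
      using js(2) that unfolding m_def by (auto simp: in_set_conv_nth nth_eq_iff_index_eq)
    then show ?thesis
      using that by (simp add: v_def m_def take_Suc_conv_app_nth indicator_vec_insert)
  qed
  have cube: "c + indicator_vec S \<in> ?X" if "S \<subseteq> set js" for S
    unfolding discrete_box_def
  proof safe
    fix i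
    show "(c + indicator_vec S) $ i \<in> \<int>" by (simp add: c_def)
    have "a i \<le> ereal (C i)" by (fact C(1))
    also have "ereal (C i) \<le> ereal ((c + indicator_vec S) $ i)" by (simp add: c_def)
    finally show "a i \<le> ereal ((c + indicator_vec S) $ i)" .
    show "ereal ((c + indicator_vec S) $ i) \<le> b i"
      using C(2,5)[of i] that js(1) by (auto simp: c_def)
  qed
  have flat: "z $ i = c $ i" if "z \<in> ?X" "i \<notin> set js" for z i
    using that C(6)[of i] js(1) by (auto simp: discrete_box_def c_def intro!: antisym dest!: spec[of _ i])
  have parts: "(\<Sum>k\<le>m. \<mu> k *\<^sub>R G k) = G 0 + (\<Sum>k<m. t (js ! k) *\<^sub>R (G (Suc k) - G k))"
    for G :: "nat \<Rightarrow> 'b::real_vector"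
    unfolding \<mu>_def sum_by_parts by (simp add: \<tau>_def)
  show thesis
  proof
    show "v k \<in> ?X" for k
      unfolding v_def by (rule cube) (rule set_take_subset)
    show "0 \<le> \<mu> k" for k
    proof -
      have "t (js ! k) \<le> t (js ! (k - 1))" if "0 < k" "k < m"
        using sorted_nth_mono[OF js(3), of "k - 1" k] that by (auto simp: m_def)
      then show ?thesis using t01 by (auto simp: \<mu>_def \<tau>_def)
    qed
    show "(\<Sum>k\<le>m. \<mu> k) = 1"
      using parts[of "\<lambda>_. 1::real"] by simp
    have "(\<Sum>k<m. t (js ! k) *\<^sub>R axis (js ! k) 1) = (\<Sum>i\<in>J. t i *\<^sub>R axis i (1::real))"
      using js by (intro sum.reindex_bij_betw bij_betw_nth) (auto simp: m_def)
    also have "\<dots> = x - c"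
      by (auto simp: Finite_Cartesian_Product.vec_eq_iff axis_def t_def tJ[unfolded t_def]
          if_distrib[of "\<lambda>s. _ * s"] cong: if_cong)
    finally have sum_axis: "(\<Sum>k<m. t (js ! k) *\<^sub>R axis (js ! k) (1::real)) = x - c" .
    then show "(\<Sum>k\<le>m. \<mu> k *\<^sub>R v k) = x"
      unfolding parts by (simp add: step) (simp add: v_def)
    fix f \<eta>
    assume f: "L_natural_convex_on ?X f" and \<eta>: "(\<eta>, x) \<in> convex hull (epigraph_on ?X f)"
    \<comment> \<open>The step from \<open>v k\<close> to \<open>v (Suc k)\<close> changes only the
      coordinate \<open>js ! k\<close>, so storing the increment of \<open>f\<close> there makes
      \<open>r + q \<bullet> z\<close> interpolate \<open>f\<close> on the whole chain.\<close>
    define q where "q = (\<Sum>k<m. (f (v (Suc k)) - f (v k)) *\<^sub>R axis (js ! k) (1::real))"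
    define r where "r = f c - q \<bullet> c"
    have "r + q \<bullet> z \<le> f z" if z: "z \<in> ?X" for z
    proof -
      have "0 \<le> f z - (r + q \<bullet> z)"
      proof (rule nonneg_of_chain_zero[OF ab _ cube flat _ z, where g = "\<lambda>z. f z - (r + q \<bullet> z)"])
        show "L_natural_convex_on ?X (\<lambda>z. f z - (r + q \<bullet> z))"
          unfolding L_natural_convex_on_def
        proof (intro ballI)
          fix y z assume yz: "y \<in> ?X" "z \<in> ?X"
          let ?p = "ceil_vec ((1/2) *\<^sub>R (y + z))" and ?s = "floor_vec ((1/2) *\<^sub>R (y + z))"
          have "q \<bullet> ?p + q \<bullet> ?s = q \<bullet> y + q \<bullet> z"
            using ceil_vec_add_floor_vec[OF yz] by (metis inner_add_right)
          moreover have "f ?p + f ?s \<le> f y + f z"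
            using f yz by (auto simp: L_natural_convex_on_def)
          ultimately show "f ?p - (r + q \<bullet> ?p) + (f ?s - (r + q \<bullet> ?s)) \<le> f y - (r + q \<bullet> y) + (f z - (r + q \<bullet> z))"
            by linarith
        qed
        fix k assume "k \<le> length js"
        then have "f (v k) - (r + q \<bullet> v k) = 0"
        proof (induction k)
          case 0
          show ?case by (simp add: v_def r_def)
        next
          case (Suc k)
          then have k: "k < m" by (simp add: m_def)
          have "q \<bullet> (v (Suc k) - v k) = (\<Sum>l<m. if l = k then f (v (Suc l)) - f (v l) else 0)"
            unfolding step[OF k] q_def inner_sum_left using k js(2)
            by (intro sum.cong) (auto simp: inner_axis_axis m_def nth_eq_iff_index_eq)
          then have "q \<bullet> v (Suc k) = q \<bullet> v k + (f (v (Suc k)) - f (v k))"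
            using k by (simp add: inner_diff_right)
          then show ?case using Suc by simp
        qed
        then show "f (c + indicator_vec (set (take k js))) - (r + q \<bullet> (c + indicator_vec (set (take k js)))) = 0"
          by (simp add: v_def)
      qed
      then show ?thesis by simp
    qed
    then have "epigraph_on ?X f \<subseteq> {p. (-1, q) \<bullet> p \<le> - r}"
      by (force simp: epigraph_on_def)
    then have "convex hull (epigraph_on ?X f) \<subseteq> {p. (-1, q) \<bullet> p \<le> - r}"
      by (rule hull_minimal) (rule convex_halfspace_le)
    with \<eta> have "r + q \<bullet> x \<le> \<eta>" by auto
    moreover have "(\<Sum>k\<le>m. \<mu> k * f (v k)) = r + q \<bullet> x"
    proof -
      have "q \<bullet> (x - c) = (\<Sum>i\<in>J. q $ i * t i)"
        unfolding inner_vec_def using tJ by (intro sum.mono_neutral_cong_right) (auto simp: t_def)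
      also have "\<dots> = (\<Sum>k<m. q $ (js ! k) * t (js ! k))"
        using js by (intro sum.reindex_bij_betw[symmetric] bij_betw_nth) (auto simp: m_def)
      also have "\<dots> = (\<Sum>k<m. t (js ! k) * (f (v (Suc k)) - f (v k)))"
      proof (intro sum.cong refl)
        fix k assume k: "k \<in> {..<m}"
        have "q $ (js ! k) = (\<Sum>l<m. if l = k then f (v (Suc l)) - f (v l) else 0)"
          unfolding q_def sum_component using k js(2)
          by (intro sum.cong) (auto simp: axis_def m_def nth_eq_iff_index_eq)
        then show "q $ (js ! k) * t (js ! k) = t (js ! k) * (f (v (Suc k)) - f (v k))"
          using k by simp
      qed
      finally show ?thesis
        using parts[of "\<lambda>k. f (v k)"] by (simp add: r_def v_def inner_diff_right)
    qed
    ultimately show "(\<Sum>k\<le>m. \<mu> k * f (v k)) \<le> \<eta>" by simp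
  qed
qed

section \<open>Weighted medians and the minimum in \<open>F_agg\<close>\<close>

text \<open>As a function of \<open>w\<close> the right-hand side is convex and piecewise linear.
  Its right slope at \<open>s\<close> is 1 minus the weight strictly above \<open>s\<close>, its
  left slope 1 minus the weight at or above \<open>s\<close>; the hypotheses make them nonnegative
  and nonpositive.\<close>

lemma weighted_median_minimizes:
  fixes p u :: "'n::finite \<Rightarrow> real"
  assumes u: "\<And>i. 0 \<le> u i"
    and above: "(\<Sum>i | s < p i. u i) \<le> 1" and below: "1 \<le> (\<Sum>i | s \<le> p i. u i)"
  shows "s + (\<Sum>i\<in>UNIV. u i * max 0 (p i - s)) \<le> w + (\<Sum>i\<in>UNIV. u i * max 0 (p i - w))"
proof (cases "s \<le> w")
  case True
  have "(\<Sum>i\<in>UNIV. u i * max 0 (p i - s))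
      \<le> (\<Sum>i\<in>UNIV. u i * max 0 (p i - w) + (w - s) * (if s < p i then u i else 0))"
  proof (rule sum_mono)
    fix i
    have "u i * max 0 (p i - s) \<le> u i * (max 0 (p i - w) + (if s < p i then w - s else 0))"
      using True by (intro mult_left_mono u) auto
    then show "u i * max 0 (p i - s) \<le> u i * max 0 (p i - w) + (w - s) * (if s < p i then u i else 0)"
      by (auto simp: algebra_simps)
  qed
  also have "\<dots> = (\<Sum>i\<in>UNIV. u i * max 0 (p i - w)) + (w - s) * (\<Sum>i | s < p i. u i)"
    by (simp add: sum.distrib sum.If_cases flip: sum_distrib_left)
  also have "(w - s) * (\<Sum>i | s < p i. u i) \<le> w - s"
    using True above by (simp add: mult_left_le)
  finally show ?thesis by simp
next
  case False
  have "(\<Sum>i\<in>UNIV. u i * max 0 (p i - s)) + (s - w) * (\<Sum>i | s \<le> p i. u i)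
      = (\<Sum>i\<in>UNIV. u i * max 0 (p i - s) + (s - w) * (if s \<le> p i then u i else 0))"
    by (simp add: sum.distrib sum.If_cases flip: sum_distrib_left)
  also have "\<dots> \<le> (\<Sum>i\<in>UNIV. u i * max 0 (p i - w))"
  proof (rule sum_mono)
    fix i
    have "u i * (max 0 (p i - s) + (if s \<le> p i then s - w else 0)) \<le> u i * max 0 (p i - w)"
      using False by (intro mult_left_mono u) auto
    then show "u i * max 0 (p i - s) + (s - w) * (if s \<le> p i then u i else 0) \<le> u i * max 0 (p i - w)"
      by (auto simp: algebra_simps)
  qed
  finally have "(\<Sum>i\<in>UNIV. u i * max 0 (p i - s)) + (s - w) * (\<Sum>i | s \<le> p i. u i)
    \<le> (\<Sum>i\<in>UNIV. u i * max 0 (p i - w))" .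
  moreover have "s - w \<le> (s - w) * (\<Sum>i | s \<le> p i. u i)"
    using False below mult_left_mono[of 1 _ "s - w"] by simp
  ultimately show ?thesis by linarith
qed

text \<open>Take the largest value \<open>p j\<close> with weight at least 1 at or above it. If the
  weight strictly above were still at least 1, the next larger value would also qualify. The strict
  inequality is needed for \<open>F_agg_truncate\<close>.\<close>

lemma weighted_median_exists:
  fixes p u :: "'n::finite \<Rightarrow> real"
  assumes "1 \<le> (\<Sum>i\<in>UNIV. u i)"
  obtains j where "(\<Sum>i | p j < p i. u i) < 1" "1 \<le> (\<Sum>i | p j \<le> p i. u i)"
proof -
  define A where "A = {j. 1 \<le> (\<Sum>i | p j \<le> p i. u i)}"
  have "Min (range p) \<in> range p" by (rule Min_in) auto
  then obtain j0 where "p j0 = Min (range p)" by (metis rangeE)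
  then have "p j0 \<le> p i" for i by simp
  then have "j0 \<in> A" using assms by (simp add: A_def)
  then have ne: "p ` A \<noteq> {}" by auto
  obtain j where j: "j \<in> A" "p j = Max (p ` A)"
    using Max_in[OF _ ne] by auto
  have jmax: "p k \<le> p j" if "k \<in> A" for k
    unfolding j(2) using that by simp
  have "(\<Sum>i | p j < p i. u i) < 1"
  proof (rule ccontr)
    assume "\<not> ?thesis"
    then have ge: "1 \<le> (\<Sum>i | p j < p i. u i)" by simp
    let ?Q = "{i. p j < p i}"
    have Q: "p ` ?Q \<noteq> {}"
      using ge by (metis (no_types) image_empty image_is_empty not_one_le_zero sum.empty)
    obtain k where k: "k \<in> ?Q" "p k = Min (p ` ?Q)"
      using Min_in[OF _ Q] by auto
    have "{i. p k \<le> p i} = ?Q"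
      using k by (auto simp: Min_le_iff)
    then have "k \<in> A" using ge by (simp add: A_def)
    then show False using jmax k(1) by force
  qed
  then show thesis using that j(1) by (simp add: A_def)
qed

lemma F_agg_le: "F_agg h u0 u x \<le> u0 * h j x + (\<Sum>i\<in>UNIV. u $ i * gap h j i x)"
  unfolding F_agg_def by (rule Min_le) auto

lemma F_agg_attained: "\<exists>j. F_agg h u0 u x = u0 * h j x + (\<Sum>i\<in>UNIV. u $ i * gap h j i x)"
proof -
  have "F_agg h u0 u x \<in> range (\<lambda>j. u0 * h j x + (\<Sum>i\<in>UNIV. u $ i * gap h j i x))"
    unfolding F_agg_def by (rule Min_in) auto
  then show ?thesis by auto
qed

lemma F_agg_scale:
  assumes "0 \<le> t"
  shows "F_agg h (t * u0) (t *\<^sub>R u) x = t * F_agg h u0 u x"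
proof (rule antisym)
  have eq: "t * u0 * h j x + (\<Sum>i\<in>UNIV. (t *\<^sub>R u) $ i * gap h j i x)
    = t * (u0 * h j x + (\<Sum>i\<in>UNIV. u $ i * gap h j i x))" for j
    by (simp add: distrib_left sum_distrib_left mult.assoc)
  show "F_agg h (t * u0) (t *\<^sub>R u) x \<le> t * F_agg h u0 u x"
    using F_agg_attained[of h u0 u x] F_agg_le[of h "t * u0" "t *\<^sub>R u" x] unfolding eq by metis
  show "t * F_agg h u0 u x \<le> F_agg h (t * u0) (t *\<^sub>R u) x"
    using F_agg_attained[of h "t * u0" "t *\<^sub>R u" x] mult_left_mono[OF F_agg_le[of h u0 u x] assms]
    unfolding eq by metis
qed

text \<open>Choosing an index \<open>j\<close> amounts to choosing \<open>w = h j x\<close> in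
  \<open>weighted_median_minimizes\<close>. The formula stays valid, and affine in \<open>u\<close>,
  as long as the two subset sums stay on their sides of 1.\<close>

lemma F_agg_at_median:
  assumes "\<And>i. 0 \<le> u $ i"
    and "(\<Sum>i | h j x < h i x. u $ i) \<le> 1" "1 \<le> (\<Sum>i | h j x \<le> h i x. u $ i)"
  shows "F_agg h 1 u x = h j x + (\<Sum>i\<in>UNIV. u $ i * gap h j i x)"
proof (rule antisym)
  show "F_agg h 1 u x \<le> h j x + (\<Sum>i\<in>UNIV. u $ i * gap h j i x)"
    using F_agg_le[of h 1] by simp
  obtain k where "F_agg h 1 u x = h k x + (\<Sum>i\<in>UNIV. u $ i * gap h k i x)"
    using F_agg_attained[of h 1] by auto
  then show "h j x + (\<Sum>i\<in>UNIV. u $ i * gap h j i x) \<le> F_agg h 1 u x"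
    using weighted_median_minimizes[of "\<lambda>i. u $ i" "h j x" "\<lambda>i. h i x" "h k x"] assms by (simp add: gap_def)
qed

text \<open>A median minimizes over all real \<open>w\<close>, not only over the values
  \<open>h j x\<close>, and \<open>y $ i\<close> is at least \<open>max 0 (h i x - w)\<close>. This
  is the validity of the aggregated inequalities on \<open>P_H\<close>.\<close>

lemma F_agg_le_aggregate:
  assumes u: "\<And>i. 0 \<le> u $ i" "1 \<le> (\<Sum>i\<in>UNIV. u $ i)"
    and y: "\<And>i. 0 \<le> y $ i" "\<And>i. h i x - y $ i \<le> w"
  shows "F_agg h 1 u x \<le> w + u \<bullet> y"
proof -
  obtain j where j: "(\<Sum>i | h j x < h i x. u $ i) < 1" "1 \<le> (\<Sum>i | h j x \<le> h i x. u $ i)"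
    using weighted_median_exists[OF u(2), of "\<lambda>i. h i x"] by blast
  have "F_agg h 1 u x \<le> w + (\<Sum>i\<in>UNIV. u $ i * max 0 (h i x - w))"
    using weighted_median_minimizes[of "\<lambda>i. u $ i" "h j x" "\<lambda>i. h i x" w] u j
      F_agg_at_median[of u h j x] by (simp add: gap_def)
  also have "(\<Sum>i\<in>UNIV. u $ i * max 0 (h i x - w)) \<le> u \<bullet> y"
    unfolding inner_vec_def inner_real_def
    using y by (intro sum_mono mult_left_mono u) (auto simp: algebra_simps)
  finally show ?thesis by simp
qed

text \<open>An index whose weight is cut to 1 cannot lie strictly above a median of the cut weights,
  so its gap there is 0 and the cut does not change the value at that median.\<close>

lemma F_agg_truncate:
  assumes u: "\<And>i. 0 \<le> u $ i" "1 \<le> (\<Sum>i\<in>UNIV. min 1 (u $ i))"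
  shows "F_agg h 1 u x \<le> F_agg h 1 (\<chi> i. min 1 (u $ i)) x"
proof -
  let ?u = "\<chi> i. min 1 (u $ i)"
  have pos: "0 \<le> ?u $ i" for i using u(1) by simp
  obtain j where j: "(\<Sum>i | h j x < h i x. ?u $ i) < 1" "1 \<le> (\<Sum>i | h j x \<le> h i x. ?u $ i)"
    using weighted_median_exists[of "\<lambda>i. ?u $ i" "\<lambda>i. h i x"] u(2) by auto
  have same: "?u $ i = u $ i" if "h j x < h i x" for i
  proof -
    have "?u $ i \<le> (\<Sum>i | h j x < h i x. ?u $ i)"
      using that pos by (intro member_le_sum) auto
    then show ?thesis using j(1) by (auto simp: min_def split: if_splits)
  qed
  have "(\<Sum>i\<in>UNIV. u $ i * gap h j i x) = (\<Sum>i\<in>UNIV. ?u $ i * gap h j i x)"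
  proof (intro sum.cong refl)
    fix i
    show "u $ i * gap h j i x = ?u $ i * gap h j i x"
      using same[of i] by (cases "h j x < h i x") (simp_all add: gap_def)
  qed
  then show ?thesis
    using F_agg_at_median[of ?u h j x] pos j F_agg_le[of h 1 u x j] by simp
qed

section \<open>Cells of the arrangement of subset sums equal to 1, and their extreme points\<close>

text \<open>The closed cell of \<open>u\<close> within the nonnegative orthant; a subset sum of
  \<open>u\<close> equal to 1 falls under both families and becomes an equation. The form as an
  intersection of halfspaces gives convexity and closedness directly.\<close>

definition sign_cell :: "real ^ 'n::finite \<Rightarrow> (real ^ 'n) set" where
  "sign_cell u = (\<Inter>i. {d. 0 \<le> axis i 1 \<bullet> d})
     \<inter> (\<Inter>S\<in>{S. (\<Sum>i\<in>S. u $ i) \<le> 1}. {d. indicator_vec S \<bullet> d \<le> 1})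
     \<inter> (\<Inter>S\<in>{S. 1 \<le> (\<Sum>i\<in>S. u $ i)}. {d. 1 \<le> indicator_vec S \<bullet> d})"

lemma mem_sign_cell:
  "d \<in> sign_cell u \<longleftrightarrow> (\<forall>i. 0 \<le> d $ i) \<and>
    (\<forall>S. ((\<Sum>i\<in>S. u $ i) \<le> 1 \<longrightarrow> (\<Sum>i\<in>S. d $ i) \<le> 1) \<and>
         (1 \<le> (\<Sum>i\<in>S. u $ i) \<longrightarrow> 1 \<le> (\<Sum>i\<in>S. d $ i)))"
proof -
  have "indicator_vec S \<bullet> d = (\<Sum>i\<in>S. d $ i)" for S
    by (metis inner_commute inner_indicator_vec)
  moreover have "axis i 1 \<bullet> d = d $ i" for i
    by (simp add: inner_axis')
  ultimately show ?thesis by (auto simp: sign_cell_def)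
qed

lemma convex_sign_cell: "convex (sign_cell u)"
  unfolding sign_cell_def
  by (intro convex_Int convex_INT convex_halfspace_le convex_halfspace_ge)

text \<open>The constraints of the singletons bound every coordinate by 1, which is the purpose of
  truncating the weights.\<close>

lemma compact_sign_cell:
  fixes u :: "real ^ 'n::finite"
  assumes "\<And>i. u $ i \<le> 1"
  shows "compact (sign_cell u)"
proof -
  have "closed (sign_cell u)"
    unfolding sign_cell_def
    by (intro closed_Int closed_INT ballI closed_halfspace_le closed_halfspace_ge)
  moreover have "bounded (sign_cell u)"
  proof (rule boundedI)
    fix d assume d: "d \<in> sign_cell u"
    have "\<bar>d $ i\<bar> \<le> 1" for i
    proof -
      have "d $ i \<le> 1" using d assms[of i] unfolding mem_sign_cell by (auto dest!: spec[of _ "{i}"])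
      moreover have "0 \<le> d $ i" using d by (simp add: mem_sign_cell)
      ultimately show ?thesis by simp
    qed
    then have "(\<Sum>i\<in>UNIV. \<bar>d $ i\<bar>) \<le> (\<Sum>i\<in>(UNIV :: 'n set). 1)" by (intro sum_mono)
    then show "norm d \<le> real CARD('n)" using norm_le_l1_cart[of d] by simp
  qed
  ultimately show ?thesis by (simp add: compact_eq_bounded_closed)
qed

lemma uniform_small_scale:
  fixes f r :: "'a \<Rightarrow> real"
  assumes "finite A" "\<And>x. x \<in> A \<Longrightarrow> 0 < r x"
  shows "\<exists>\<epsilon>>0. \<forall>x\<in>A. \<epsilon> * \<bar>f x\<bar> \<le> r x"
  using assms
proof (induction A rule: finite_induct)
  case empty
  show ?case by (auto intro: exI[of _ 1])
next
  case (insert y A)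
  then obtain \<epsilon> where \<epsilon>: "0 < \<epsilon>" "\<forall>x\<in>A. \<epsilon> * \<bar>f x\<bar> \<le> r x" by auto
  \<comment> \<open>The added 1 covers the case \<open>f y = 0\<close>.\<close>
  define \<delta> where "\<delta> = min \<epsilon> (r y / (\<bar>f y\<bar> + 1))"
  have ry: "0 < r y" using insert.prems by simp
  have "0 < \<delta>" using \<epsilon>(1) ry by (simp add: \<delta>_def)
  moreover have "\<delta> * \<bar>f y\<bar> \<le> r y"
  proof -
    have "\<delta> * \<bar>f y\<bar> \<le> r y / (\<bar>f y\<bar> + 1) * (\<bar>f y\<bar> + 1)"
      using ry by (intro mult_mono) (auto simp: \<delta>_def)
    then show ?thesis by (simp add: add_nonneg_eq_0_iff)
  qed
  moreover have "\<delta> * \<bar>f x\<bar> \<le> r x" if "x \<in> A" for x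
    using \<epsilon>(2) that mult_right_mono[of \<delta> \<epsilon> "\<bar>f x\<bar>"] by (force simp: \<delta>_def)
  ultimately show ?case by (intro exI[of _ \<delta>]) auto
qed

text \<open>
  Otherwise some nonzero \<open>d\<close> supported in \<open>M\<close> is orthogonal to all tight constraints, and \<open>u\<close> is
  the midpoint of \<open>u - \<epsilon> d\<close> and \<open>u + \<epsilon> d\<close>.
\<close>

lemma span_tight_of_extreme_point:
  fixes u0 u :: "real ^ 'n::finite"
  assumes ext: "u extreme_point_of sign_cell u0"
  defines "M \<equiv> {i. u $ i \<noteq> 0}"
  shows "span (indicator_vec ` {S. S \<subseteq> M \<and> (\<Sum>i\<in>S. u $ i) = 1}) = {d. \<forall>i. i \<notin> M \<longrightarrow> d $ i = 0}"
    (is "span ?W = ?V")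
proof (rule ccontr)
  assume ne: "span ?W \<noteq> ?V"
  have u: "u \<in> sign_cell u0" using ext by (simp add: extreme_point_of_def)
  then have upos: "0 \<le> u $ i" for i by (simp add: mem_sign_cell)
  have V: "subspace ?V" by (auto simp: subspace_def)
  have "span ?W \<subseteq> ?V"
    by (rule span_minimal[OF _ V]) auto
  moreover have "span ?V = ?V" using V by (rule span_eq_iff[THEN iffD2])
  ultimately have "span ?W \<subset> span ?V" using ne by (simp only: psubset_eq) blast
  then obtain d where d: "d \<noteq> 0" "d \<in> span ?V" "\<And>y. y \<in> span ?W \<Longrightarrow> Linear_Algebra.orthogonal d y"
    using orthogonal_to_subspace_exists_gen by blast
  have dM: "d $ i = 0" if "i \<notin> M" for i
  proof -
    have "d \<in> ?V" using d(2) unfolding \<open>span ?V = ?V\<close> .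
    then show ?thesis using that by simp
  qed
  \<comment> \<open>Both \<open>u\<close> and \<open>d\<close> vanish outside \<open>M\<close>, so
    \<open>S\<close> may be replaced by \<open>S \<inter> M\<close>.\<close>
  have tight: "(\<Sum>i\<in>S. d $ i) = 0" if "(\<Sum>i\<in>S. u $ i) = 1" for S
  proof -
    have "(\<Sum>i\<in>S \<inter> M. u $ i) = (\<Sum>i\<in>S. u $ i)"
      by (rule sum.mono_neutral_left) (auto simp: M_def)
    then have "indicator_vec (S \<inter> M) \<in> ?W" using that by auto
    then have "d \<bullet> indicator_vec (S \<inter> M) = 0"
      using d(3)[OF span_base] by (simp only: Linear_Algebra.orthogonal_def)
    moreover have "(\<Sum>i\<in>S \<inter> M. d $ i) = (\<Sum>i\<in>S. d $ i)"
      using dM by (intro sum.mono_neutral_left) auto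
    ultimately show ?thesis by (simp add: inner_indicator_vec)
  qed
  \<comment> \<open>The first scale keeps the coordinates in \<open>M\<close> nonnegative, the
    second keeps the non-tight subset sums on their side of 1.\<close>
  obtain \<epsilon>1 where \<epsilon>1: "\<epsilon>1 > 0" "\<And>i. i \<in> M \<Longrightarrow> \<epsilon>1 * \<bar>d $ i\<bar> \<le> u $ i"
    using uniform_small_scale[of M "\<lambda>i. u $ i" "\<lambda>i. d $ i"] upos
    by (auto simp: M_def less_le)
  obtain \<epsilon>2 where \<epsilon>2: "\<epsilon>2 > 0"
    "\<And>S. (\<Sum>i\<in>S. u $ i) \<noteq> 1 \<Longrightarrow> \<epsilon>2 * \<bar>\<Sum>i\<in>S. d $ i\<bar> \<le> \<bar>(\<Sum>i\<in>S. u $ i) - 1\<bar>"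
    using uniform_small_scale[of "{S. (\<Sum>i\<in>S. u $ i) \<noteq> 1}" "\<lambda>S. \<bar>(\<Sum>i\<in>S. u $ i) - 1\<bar>" "\<lambda>S. \<Sum>i\<in>S. d $ i"]
    by auto
  define \<epsilon> where "\<epsilon> = min \<epsilon>1 \<epsilon>2"
  have \<epsilon>: "\<epsilon> > 0" using \<epsilon>1 \<epsilon>2 by (simp add: \<epsilon>_def)
  have shift: "u + \<sigma> *\<^sub>R d \<in> sign_cell u0" if \<sigma>: "\<bar>\<sigma>\<bar> = \<epsilon>" for \<sigma>
  proof -
    have "0 \<le> u $ i + \<sigma> * d $ i" for i
    proof (cases "i \<in> M")
      case True
      have "\<bar>\<sigma> * d $ i\<bar> \<le> \<epsilon>1 * \<bar>d $ i\<bar>"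
        using \<sigma> by (simp add: abs_mult mult_right_mono \<epsilon>_def)
      with \<epsilon>1(2)[OF True] show ?thesis by linarith
    qed (use dM upos in auto)
    moreover have "((\<Sum>i\<in>S. u0 $ i) \<le> 1 \<longrightarrow> (\<Sum>i\<in>S. u $ i + \<sigma> * d $ i) \<le> 1) \<and>
         (1 \<le> (\<Sum>i\<in>S. u0 $ i) \<longrightarrow> 1 \<le> (\<Sum>i\<in>S. u $ i + \<sigma> * d $ i))" for S
    proof -
      have eq: "(\<Sum>i\<in>S. u $ i + \<sigma> * d $ i) = (\<Sum>i\<in>S. u $ i) + \<sigma> * (\<Sum>i\<in>S. d $ i)"
        by (simp add: sum.distrib sum_distrib_left)
      have uS: "(\<Sum>i\<in>S. u0 $ i) \<le> 1 \<longrightarrow> (\<Sum>i\<in>S. u $ i) \<le> 1" "1 \<le> (\<Sum>i\<in>S. u0 $ i) \<longrightarrow> 1 \<le> (\<Sum>i\<in>S. u $ i)"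
        using u by (simp_all add: mem_sign_cell)
      show ?thesis
      proof (cases "(\<Sum>i\<in>S. u $ i) = 1")
        case True
        then show ?thesis using tight[OF True] by (simp add: eq)
      next
        case False
        have "\<bar>\<sigma> * (\<Sum>i\<in>S. d $ i)\<bar> \<le> \<epsilon>2 * \<bar>\<Sum>i\<in>S. d $ i\<bar>"
          using \<sigma> by (simp add: abs_mult mult_right_mono \<epsilon>_def)
        with \<epsilon>2(2)[OF False] uS show ?thesis unfolding eq by linarith
      qed
    qed
    ultimately show ?thesis by (simp add: mem_sign_cell)
  qed
  have "u - \<epsilon> *\<^sub>R d \<noteq> u + \<epsilon> *\<^sub>R d" using d(1) \<epsilon> by (simp add: algebra_simps flip: scaleR_2)
  then have "midpoint (u - \<epsilon> *\<^sub>R d) (u + \<epsilon> *\<^sub>R d) \<in> open_segment (u - \<epsilon> *\<^sub>R d) (u + \<epsilon> *\<^sub>R d)"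
    by simp
  moreover have "midpoint (u - \<epsilon> *\<^sub>R d) (u + \<epsilon> *\<^sub>R d) = u"
    by (simp add: midpoint_def flip: scaleR_2)
  ultimately show False
    using ext shift[of \<epsilon>] shift[of "- \<epsilon>"] \<epsilon> by (auto simp: extreme_point_of_def)
qed

text \<open>The indicator vectors of tight sets span the coordinate space of the support
  \<open>M\<close>, so \<open>card M\<close> of them form a basis. Taken as rows, they give an
  invertible binary matrix that maps the restriction of \<open>u\<close> to the all-ones
  vector.\<close>

lemma extreme_point_in_U_fin:
  fixes u0 u :: "real ^ 'n::finite"
  assumes ext: "u extreme_point_of sign_cell u0" and u0: "1 \<le> (\<Sum>i\<in>UNIV. u0 $ i)"
  shows "u \<in> U_fin"
proof -
  define M where "M = {i. u $ i \<noteq> 0}"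
  define W where "W = (indicator_vec ` {S. S \<subseteq> M \<and> (\<Sum>i\<in>S. u $ i) = 1} :: (real ^ 'n) set)"
  define m where "m = card M"
  have u: "u \<in> sign_cell u0" using ext by (simp add: extreme_point_of_def)
  have "1 \<le> (\<Sum>i\<in>UNIV. u $ i)" using u u0 by (simp add: mem_sign_cell)
  then have M: "M \<noteq> {}" unfolding M_def by force
  have span_W: "span W = {d. \<forall>i. i \<notin> M \<longrightarrow> d $ i = 0}"
    unfolding W_def M_def by (rule span_tight_of_extreme_point[OF ext])
  have dim_W: "dim W = m"
  proof -
    let ?d = "(\<lambda>i. axis i (1::real)) ` M"
    have "{x. \<forall>b\<in>Basis. b \<notin> ?d \<longrightarrow> x \<bullet> b = 0} = span W"
      unfolding span_W by (auto simp: Basis_vec_def inner_axis axis_eq_axis)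
    moreover have "dim {x. \<forall>b\<in>Basis. b \<notin> ?d \<longrightarrow> x \<bullet> b = 0} = card ?d"
      by (rule dim_substandard) (auto simp: Basis_vec_def)
    moreover have "card ?d = m"
      unfolding m_def by (rule card_image) (auto simp: inj_on_def axis_eq_axis)
    ultimately have "dim (span W) = m" by simp
    then show ?thesis unfolding dim_span .
  qed
  obtain Bs where Bs: "Bs \<subseteq> W" "independent Bs" "W \<subseteq> span Bs" "card Bs = dim W"
    by (rule basis_exists[of W])
  have fin: "finite Bs" using Bs(2) by (rule independent_imp_finite)
  obtain f where f: "bij_betw f {..<m} Bs"
    using ex_bij_betw_nat_finite[OF fin] Bs(4) dim_W by (auto simp: lessThan_atLeast0)
  obtain e where e: "bij_betw e {..<m} M"
    using ex_bij_betw_nat_finite[of M] by (auto simp: lessThan_atLeast0 m_def)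
  have "\<exists>S. f k = indicator_vec S \<and> S \<subseteq> M \<and> (\<Sum>i\<in>S. u $ i) = 1" if "k < m" for k
    using bij_betwE[OF f] Bs(1) that by (fastforce simp: W_def)
  then obtain T where T: "\<And>k. k < m \<Longrightarrow> f k = indicator_vec (T k)" "\<And>k. k < m \<Longrightarrow> T k \<subseteq> M"
    "\<And>k. k < m \<Longrightarrow> (\<Sum>i\<in>T k. u $ i) = 1"
    by metis
  have eM: "e l \<in> M" if "l < m" for l using bij_betwE[OF e] that by simp
  have "\<exists>c. axis (e l) 1 = (\<Sum>k<m. c k *\<^sub>R f k)" if "l < m" for l
  proof -
    have "axis (e l) 1 \<in> span W" using eM[OF that] unfolding span_W by (auto simp: axis_def)
    then have "axis (e l) 1 \<in> span Bs" using Bs(3) span_mono span_span by blast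
    then obtain c where "axis (e l) 1 = (\<Sum>v\<in>Bs. c v *\<^sub>R v)"
      unfolding span_finite[OF fin] by auto
    also have "\<dots> = (\<Sum>k<m. c (f k) *\<^sub>R f k)"
      by (rule sum.reindex_bij_betw[OF f, symmetric])
    finally show ?thesis by (intro exI[of _ "\<lambda>k. c (f k)"])
  qed
  then obtain c where c: "\<And>l. l < m \<Longrightarrow> axis (e l) 1 = (\<Sum>k<m. c l k *\<^sub>R f k)"
    by metis
  \<comment> \<open>Row \<open>k\<close> of \<open>B\<close> is the basis vector \<open>f k\<close>
    read along the listing \<open>e\<close>; row \<open>l\<close> of \<open>C\<close> expands the
    axis vector of \<open>e l\<close> in that basis, which is exactly
    \<open>C * B = 1\<^sub>m m\<close>.\<close>
  define B where "B = Matrix.mat m m (\<lambda>(k, l). if e l \<in> T k then 1 else (0::real))"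
  define C where "C = Matrix.mat m m (\<lambda>(l, k). c l k)"
  have B: "B \<in> carrier_mat m m" and C: "C \<in> carrier_mat m m" by (auto simp: B_def C_def)
  have CB: "C * B = 1\<^sub>m m"
  proof (rule eq_matI)
    fix l l' assume l: "l < dim_row (1\<^sub>m m :: real mat)" "l' < dim_col (1\<^sub>m m :: real mat)"
    have "(C * B) $$ (l, l') = (\<Sum>k<m. c l k * (if e l' \<in> T k then 1 else 0))"
      using l by (simp add: B_def C_def Matrix.scalar_prod_def lessThan_atLeast0)
    also have "\<dots> = (\<Sum>k<m. c l k *\<^sub>R f k) $ e l'"
      using T(1) by simp
    also have "\<dots> = axis (e l) 1 $ e l'"
      using c[of l] l by simp
    also have "\<dots> = 1\<^sub>m m $$ (l, l')"
      using l bij_betw_imp_inj_on[OF e] by (auto simp: axis_def inj_on_def)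
    finally show "(C * B) $$ (l, l') = 1\<^sub>m m $$ (l, l')" .
  qed (auto simp: B_def C_def)
  have BC: "B * C = 1\<^sub>m m" by (rule mat_mult_left_right_inverse[OF C B CB])
  let ?uM = "Matrix.vec m (\<lambda>k. u $ e k)"
  have "B *\<^sub>v ?uM = Matrix.vec m (\<lambda>_. 1)"
  proof (rule eq_vecI)
    fix k assume k: "k < dim_vec (Matrix.vec m (\<lambda>_. 1 :: real))"
    have "vec_index (B *\<^sub>v ?uM) k = (\<Sum>l<m. (if e l \<in> T k then u $ e l else 0))"
      using k by (auto simp: B_def Matrix.scalar_prod_def lessThan_atLeast0 intro!: sum.cong)
    also have "\<dots> = (\<Sum>i\<in>M. if i \<in> T k then u $ i else 0)"
      by (rule sum.reindex_bij_betw[OF e])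
    also have "\<dots> = 1"
      using T(2,3)[of k] k by (simp add: sum.If_cases Int_absorb1)
    finally show "vec_index (B *\<^sub>v ?uM) k = vec_index (Matrix.vec m (\<lambda>_. 1)) k"
      using k by simp
  qed (simp add: B_def)
  then have "C *\<^sub>v Matrix.vec m (\<lambda>_. 1) = C *\<^sub>v (B *\<^sub>v ?uM)" by simp
  also have "\<dots> = (C * B) *\<^sub>v ?uM"
    by (rule assoc_mult_mat_vec[OF C B, symmetric]) simp
  also have "\<dots> = ?uM" unfolding CB by simp
  finally have eq: "?uM = C *\<^sub>v Matrix.vec m (\<lambda>_. 1)" by simp
  have bin: "elements_mat B \<subseteq> {0, 1}"
    by (auto simp: elements_mat_def B_def)
  have inv: "inverts_mat B C" "inverts_mat C B"
    using BC CB B C by (auto simp: inverts_mat_def)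
  show ?thesis
    unfolding U_fin_def mem_Collect_eq
  proof (rule conjI)
    show "\<forall>i. 0 \<le> u $ i" using u by (simp add: mem_sign_cell)
  qed (rule exI[of _ M], rule exI[of _ e], rule exI[of _ B], rule exI[of _ C],
      use M e B C bin inv eq in \<open>simp add: m_def, simp add: M_def\<close>)
qed

text \<open>Any one row of \<open>B\<close> picks out a subset sum of \<open>u\<close> equal to 1,
  and the remaining entries are nonnegative.\<close>

lemma one_le_sum_of_U_fin:
  assumes u: "u \<in> U_fin"
  shows "1 \<le> (\<Sum>i\<in>UNIV. u $ i)"
proof -
  obtain M e and B C :: "real mat" where pos: "\<And>i. 0 \<le> u $ i" and M: "M \<noteq> {}" and e: "bij_betw e {..<card M} M"
    and B: "B \<in> carrier_mat (card M) (card M)" and C: "C \<in> carrier_mat (card M) (card M)"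
    and bin: "elements_mat B \<subseteq> {0, 1}" and BC: "inverts_mat B C"
    and eq: "Matrix.vec (card M) (\<lambda>k. u $ e k) = C *\<^sub>v Matrix.vec (card M) (\<lambda>_. 1)"
    using u unfolding U_fin_def by blast
  let ?m = "card M"
  let ?uM = "Matrix.vec ?m (\<lambda>k. u $ e k)"
  have m: "0 < ?m" using M by (simp add: card_gt_0_iff)
  have "B *\<^sub>v ?uM = (B * C) *\<^sub>v Matrix.vec ?m (\<lambda>_. 1)"
    unfolding eq by (rule assoc_mult_mat_vec[OF B C, symmetric]) simp
  also have "\<dots> = Matrix.vec ?m (\<lambda>_. 1)"
    using BC B by (simp add: inverts_mat_def)
  finally have "vec_index (B *\<^sub>v ?uM) 0 = 1" using m by simp
  then have "1 = (\<Sum>l<?m. B $$ (0, l) * u $ e l)"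
    using m B by (simp add: Matrix.scalar_prod_def lessThan_atLeast0)
  also have "\<dots> \<le> (\<Sum>l<?m. u $ e l)"
  proof (rule sum_mono)
    fix l assume "l \<in> {..<?m}"
    then have "B $$ (0, l) \<in> elements_mat B"
      using m B by (intro elements_matI[of B ?m ?m]) auto
    then show "B $$ (0, l) * u $ e l \<le> u $ e l" using bin pos by auto
  qed
  also have "\<dots> = (\<Sum>i\<in>M. u $ i)" by (rule sum.reindex_bij_betw[OF e])
  also have "\<dots> \<le> (\<Sum>i\<in>UNIV. u $ i)" using pos by (intro sum_mono2) auto
  finally show ?thesis .
qed

lemma U_fin_nonneg: "u \<in> U_fin \<Longrightarrow> 0 \<le> u $ i"
  by (auto simp: U_fin_def)

section \<open>From the finitely many weights in \<open>U_fin\<close> to all weights of sum at least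
  1\<close>

text \<open>
  On the sign cell of the truncation of \<open>u\<close> the weighted medians do not change, so both sides are
  affine there and it is enough to compare them at the extreme points.
\<close>

lemma weighted_F_agg_le:
  fixes y u :: "real ^ 'n::finite"
  assumes \<mu>: "\<And>k. k \<in> K \<Longrightarrow> 0 \<le> \<mu> k"
    and y: "\<And>i. 0 \<le> y $ i"
    and fin: "\<And>u. u \<in> U_fin \<Longrightarrow> (\<Sum>k\<in>K. \<mu> k * F_agg h 1 u (v k)) \<le> w + u \<bullet> y"
    and u: "\<And>i. 0 \<le> u $ i" "1 \<le> (\<Sum>i\<in>UNIV. u $ i)"
  shows "(\<Sum>k\<in>K. \<mu> k * F_agg h 1 u (v k)) \<le> w + u \<bullet> y"
proof -
  \<comment> \<open>Passing to \<open>t\<close> loses nothing: the left-hand side does not decrease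
    by \<open>F_agg_truncate\<close>, and \<open>t \<bullet> y \<le> u \<bullet> y\<close>.\<close>
  define t where "t = (\<chi> i. min 1 (u $ i))"
  have t: "0 \<le> t $ i" "t $ i \<le> 1" "t $ i \<le> u $ i" for i using u(1) by (auto simp: t_def)
  have t_sum: "1 \<le> (\<Sum>i\<in>UNIV. t $ i)"
  proof (cases "\<exists>i. 1 \<le> u $ i")
    case True
    then obtain i where "1 \<le> t $ i" by (auto simp: t_def)
    also have "t $ i \<le> (\<Sum>i\<in>UNIV. t $ i)" using t by (intro member_le_sum) auto
    finally show ?thesis .
  next
    case False
    then have "t $ i = u $ i" for i by (auto simp: t_def not_le)
    then show ?thesis using u(2) by simp
  qed
  \<comment> \<open>The medians are chosen for \<open>t\<close> only; membership in
    \<open>sign_cell t\<close> preserves both comparisons with 1, so they serve every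
    \<open>d\<close> in the cell.\<close>
  have "\<exists>j. (\<Sum>i | h j x < h i x. t $ i) < 1 \<and> 1 \<le> (\<Sum>i | h j x \<le> h i x. t $ i)" for x
    using weighted_median_exists[OF t_sum, of "\<lambda>i. h i x"] by metis
  then obtain j where j: "\<And>x. (\<Sum>i | h (j x) x < h i x. t $ i) < 1"
      "\<And>x. 1 \<le> (\<Sum>i | h (j x) x \<le> h i x. t $ i)"
    by metis
  have affine: "F_agg h 1 d x = h (j x) x + d \<bullet> (\<chi> i. gap h (j x) i x)" if "d \<in> sign_cell t" for d x
    using that j[of x] F_agg_at_median[of d h "j x" x] by (simp add: mem_sign_cell inner_vec_def less_imp_le)
  define q where "q = (\<Sum>k\<in>K. \<mu> k *\<^sub>R (\<chi> i. gap h (j (v k)) i (v k))) - y"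
  define r where "r = w - (\<Sum>k\<in>K. \<mu> k * h (j (v k)) (v k))"
  have iff: "(\<Sum>k\<in>K. \<mu> k * F_agg h 1 d (v k)) \<le> w + d \<bullet> y \<longleftrightarrow> q \<bullet> d \<le> r" if "d \<in> sign_cell t" for d
    by (simp add: affine[OF that] q_def r_def inner_diff_left inner_sum_left sum.distrib distrib_left
        inner_commute[of d] algebra_simps)
  have compact: "compact (sign_cell t)" using t(2) by (rule compact_sign_cell)
  have "sign_cell t \<subseteq> {d. q \<bullet> d \<le> r}"
  proof -
    have "{d. d extreme_point_of sign_cell t} \<subseteq> {d. q \<bullet> d \<le> r}"
      using extreme_point_in_U_fin[OF _ t_sum] fin iff by (auto simp: extreme_point_of_def)
    then have "convex hull {d. d extreme_point_of sign_cell t} \<subseteq> {d. q \<bullet> d \<le> r}"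
      by (rule hull_minimal) (rule convex_halfspace_le)
    then show ?thesis
      using Krein_Milman_Minkowski[OF compact convex_sign_cell] by simp
  qed
  moreover have t_in: "t \<in> sign_cell t" using t by (simp add: mem_sign_cell)
  ultimately have "(\<Sum>k\<in>K. \<mu> k * F_agg h 1 t (v k)) \<le> w + t \<bullet> y"
    using iff by blast
  moreover have "(\<Sum>k\<in>K. \<mu> k * F_agg h 1 u (v k)) \<le> (\<Sum>k\<in>K. \<mu> k * F_agg h 1 t (v k))"
    using F_agg_truncate[of u h] u(1) t_sum \<mu> unfolding t_def by (intro sum_mono mult_left_mono) auto
  moreover have "t \<bullet> y \<le> u \<bullet> y"
    unfolding inner_vec_def inner_real_def using t(3) y by (intro sum_mono mult_right_mono) auto
  ultimately show ?thesis by linarith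
qed

section \<open>The inclusion of the hull: convexity of \<open>CP_fin\<close> and validity of its
  constraints\<close>

lemma convex_relaxed_box:
  fixes a b :: "'n::finite \<Rightarrow> ereal"
  shows "convex (relaxed_box a b)"
proof (rule convexI)
  fix x y :: "real ^ 'n" and s t :: real
  assume xy: "x \<in> relaxed_box a b" "y \<in> relaxed_box a b" and st: "0 \<le> s" "0 \<le> t" "s + t = 1"
  have "a i \<le> ereal (s * x $ i + t * y $ i) \<and> ereal (s * x $ i + t * y $ i) \<le> b i" for i
  proof -
    have "s * x $ i + t * y $ i \<le> max (x $ i) (y $ i)"
      using st by (intro convex_bound_le) auto
    moreover have "s * (- x $ i) + t * (- y $ i) \<le> - min (x $ i) (y $ i)"
      using st by (intro convex_bound_le) auto
    then have "min (x $ i) (y $ i) \<le> s * x $ i + t * y $ i" by simp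
    moreover have "a i \<le> ereal (min (x $ i) (y $ i))" "ereal (max (x $ i) (y $ i)) \<le> b i"
      using xy by (auto simp: relaxed_box_def min_def max_def)
    ultimately show ?thesis by (meson ereal_less_eq(3) order_trans)
  qed
  then show "s *\<^sub>R x + t *\<^sub>R y \<in> relaxed_box a b" by (simp add: relaxed_box_def)
qed

lemma convex_CP_fin:
  fixes a b :: "'n::finite \<Rightarrow> ereal"
  shows "convex (CP_fin a b h)"
proof (rule convexI)
  fix z z' :: "real \<times> (real ^ 'n) \<times> (real ^ 'n)" and s t :: real
  assume zz: "z \<in> CP_fin a b h" "z' \<in> CP_fin a b h" and st: "0 \<le> s" "0 \<le> t" "s + t = 1"
  obtain w y x where z: "z = (w, y, x)" by (cases z)
  obtain w' y' x' where z': "z' = (w', y', x')" by (cases z')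
  have "(s * w + t * w' + u \<bullet> (s *\<^sub>R y + t *\<^sub>R y'), s *\<^sub>R x + t *\<^sub>R x')
      \<in> convex hull (epigraph_on (discrete_box a b) (F_agg h 1 u))" if "u \<in> U_fin" for u
  proof -
    have "s *\<^sub>R (w + u \<bullet> y, x) + t *\<^sub>R (w' + u \<bullet> y', x')
        \<in> convex hull (epigraph_on (discrete_box a b) (F_agg h 1 u))"
      using zz that st unfolding z z' by (intro convexD convex_convex_hull) (auto simp: CP_fin_def)
    then show ?thesis by (simp add: algebra_simps inner_add_right)
  qed
  moreover have "s *\<^sub>R x + t *\<^sub>R x' \<in> relaxed_box a b"
    using zz st unfolding z z' by (intro convexD convex_relaxed_box) (auto simp: CP_fin_def)
  ultimately show "s *\<^sub>R z + t *\<^sub>R z' \<in> CP_fin a b h"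
    using zz st unfolding z z' by (auto simp: CP_fin_def)
qed

lemma P_H_subset_CP_fin: "P_H (discrete_box a b) h \<subseteq> CP_fin a b h"
proof
  fix z assume "z \<in> P_H (discrete_box a b) h"
  then obtain w y x where z: "z = (w, y, x)" and y: "\<And>i. 0 \<le> y $ i" "\<And>i. h i x - y $ i \<le> w"
    and x: "x \<in> discrete_box a b"
    by (auto simp: P_H_def)
  have "(w + u \<bullet> y, x) \<in> epigraph_on (discrete_box a b) (F_agg h 1 u)" if "u \<in> U_fin" for u
    using F_agg_le_aggregate[of u y h x w] y x that
    by (simp add: epigraph_on_def U_fin_nonneg one_le_sum_of_U_fin)
  then show "z \<in> CP_fin a b h"
    using x y(1) unfolding z CP_fin_def
    by (auto simp: discrete_box_def relaxed_box_def intro: hull_inc)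
qed

section \<open>Homogeneous weights and separation in the fibre over the chain\<close>

lemma nonneg_of_bounded_ray:
  fixes A B \<beta> :: real
  assumes "\<And>t. 0 \<le> t \<Longrightarrow> A - t * B < \<beta>"
  shows "0 \<le> B"
proof (rule ccontr)
  assume B: "\<not> 0 \<le> B"
  define t where "t = \<bar>\<beta> - A\<bar> / (- B)"
  have "0 \<le> t" unfolding t_def by (rule divide_nonneg_nonneg) (use B in auto)
  moreover have "t * B = - \<bar>\<beta> - A\<bar>" using B by (simp add: t_def)
  ultimately show False using assms[of t] by simp
qed

text \<open>For \<open>u0 > 0\<close>, dividing by \<open>u0\<close> reduces to weights of sum at
  least 1. For \<open>u0 = 0\<close> the left-hand side is nonpositive, since all gaps vanish at an
  index \<open>j\<close> that maximizes \<open>h j x\<close>.\<close>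

lemma weighted_F_agg_le_cone:
  fixes y u :: "real ^ 'n::finite"
  assumes \<mu>: "\<And>k. k \<in> K \<Longrightarrow> 0 \<le> \<mu> k"
    and y: "\<And>i. 0 \<le> y $ i"
    and fin: "\<And>u. u \<in> U_fin \<Longrightarrow> (\<Sum>k\<in>K. \<mu> k * F_agg h 1 u (v k)) \<le> w + u \<bullet> y"
    and u: "(u0, u) \<in> U_cone"
  shows "(\<Sum>k\<in>K. \<mu> k * F_agg h u0 u (v k)) \<le> u0 * w + u \<bullet> y"
proof (cases "u0 = 0")
  case True
  have "F_agg h 0 u x \<le> 0" for x
  proof -
    have "Max (range (\<lambda>j. h j x)) \<in> range (\<lambda>j. h j x)" by (rule Max_in) auto
    then obtain j where j: "h j x = Max (range (\<lambda>j. h j x))" by force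
    have "h i x \<le> h j x" for i unfolding j by simp
    then have "gap h j i x = 0" for i by (simp add: gap_def)
    then show ?thesis using F_agg_le[of h 0 u x j] by simp
  qed
  then have "(\<Sum>k\<in>K. \<mu> k * F_agg h 0 u (v k)) \<le> 0"
    using \<mu> by (intro sum_nonpos mult_nonneg_nonpos) auto
  also have "0 \<le> u \<bullet> y"
    unfolding inner_vec_def inner_real_def using u y by (intro sum_nonneg mult_nonneg_nonneg) (auto simp: U_cone_def)
  finally show ?thesis using True by simp
next
  case False
  then have u0: "0 < u0" using u by (simp add: U_cone_def)
  define d where "d = (1 / u0) *\<^sub>R u"
  have ud: "u = u0 *\<^sub>R d" using u0 by (simp add: d_def)
  have d: "0 \<le> d $ i" for i using u u0 by (simp add: d_def U_cone_def)
  have "(\<Sum>i\<in>UNIV. d $ i) = (\<Sum>i\<in>UNIV. u $ i) / u0"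
    by (simp add: d_def sum_divide_distrib)
  then have "1 \<le> (\<Sum>i\<in>UNIV. d $ i)" using u u0 by (simp add: U_cone_def)
  then have "(\<Sum>k\<in>K. \<mu> k * F_agg h 1 d (v k)) \<le> w + d \<bullet> y"
    by (intro weighted_F_agg_le[OF \<mu> y fin d]) auto
  then have "u0 * (\<Sum>k\<in>K. \<mu> k * F_agg h 1 d (v k)) \<le> u0 * (w + d \<bullet> y)"
    using u0 by (intro mult_left_mono) auto
  moreover have "F_agg h u0 u x = u0 * F_agg h 1 d x" for x
    using F_agg_scale[of u0 h 1 d x] u0 unfolding ud by simp
  ultimately show ?thesis
    by (simp add: ud sum_distrib_left distrib_left mult.left_commute)
qed

text \<open>
  The fibre of \<open>conv(P\<^sup>H)\<close> over the weights \<open>\<mu>\<close> contains the convex hull of finitely many points plus a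
  recession cone, and the dual of that cone is \<open>\<U>\<close>; so a point outside is cut off by some \<open>F\<^bsub>u0,u\<^esub>\<close>.
\<close>

lemma mem_convex_hull_P_H:
  fixes y x :: "real ^ 'n::finite"
  assumes K: "finite K" and \<mu>: "\<And>k. k \<in> K \<Longrightarrow> 0 \<le> \<mu> k" "(\<Sum>k\<in>K. \<mu> k) = 1"
    and v: "\<And>k. k \<in> K \<Longrightarrow> v k \<in> X" "(\<Sum>k\<in>K. \<mu> k *\<^sub>R v k) = x"
    and cone: "\<And>u0 u. (u0, u) \<in> U_cone \<Longrightarrow> (\<Sum>k\<in>K. \<mu> k * F_agg h u0 u (v k)) \<le> u0 * w + u \<bullet> y"
  shows "(w, y, x) \<in> convex hull (P_H X h)"
proof -
  \<comment> \<open>An index is chosen independently at each chain point; \<open>pt j\<close>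
    averages the resulting pairs of \<open>h\<close> and gap values.\<close>
  define pt where "pt j = (\<Sum>k\<in>K. \<mu> k *\<^sub>R (h (j k) (v k), (\<chi> i. gap h (j k) i (v k))))"
    for j :: "_ \<Rightarrow> 'n"
  define Q where "Q = convex hull (pt ` (K \<rightarrow>\<^sub>E UNIV))"
  \<comment> \<open>\<open>D\<close> is \<open>(w, y)\<close> minus the recession cone of pairs
    \<open>(p, q)\<close> with \<open>q $ i \<ge> 0\<close> and \<open>p + q $ i \<ge> 0\<close>, so
    meeting \<open>Q\<close> means that \<open>(w, y)\<close> lies in \<open>Q\<close> plus this
    cone.\<close>
  define D where "D = (\<Inter>i. {z :: real \<times> (real ^ 'n). (0, axis i 1) \<bullet> z \<le> y $ i} \<inter> {z. (1, axis i 1) \<bullet> z \<le> w + y $ i})"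
  have D_iff: "(p, q) \<in> D \<longleftrightarrow> (\<forall>i. q $ i \<le> y $ i \<and> p + q $ i \<le> w + y $ i)" for p q
    by (auto simp: D_def inner_axis')
  have finite: "finite (pt ` (K \<rightarrow>\<^sub>E UNIV))" using K by (intro finite_imageI finite_PiE) auto
  have "Q \<inter> D \<noteq> {}"
  proof
    assume disj: "Q \<inter> D = {}"
    have "convex Q" "compact Q"
      using finite by (auto simp: Q_def finite_imp_compact_convex_hull)
    moreover have "Q \<noteq> {}" by (simp add: Q_def PiE_eq_empty_iff)
    moreover have "convex D" "closed D"
      unfolding D_def
      by (intro convex_INT convex_Int convex_halfspace_le, intro closed_INT closed_Int ballI closed_halfspace_le)
    ultimately obtain c \<beta> where sep: "\<And>z. z \<in> Q \<Longrightarrow> c \<bullet> z < \<beta>" "\<And>z. z \<in> D \<Longrightarrow> \<beta> < c \<bullet> z"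
      using separating_hyperplane_compact_closed[of Q D] disj by metis
    obtain u0 u where c: "- c = (u0, u)" by (cases "- c")
    have Q_lt: "- \<beta> < (u0, u) \<bullet> z" if "z \<in> Q" for z
      using sep(1)[OF that] unfolding c[symmetric] by simp
    have D_lt: "u0 * p + u \<bullet> q < - \<beta>" if "(p, q) \<in> D" for p q
      using sep(2)[OF that] arg_cong[OF c, of "\<lambda>s. s \<bullet> (p, q)"] by simp
    \<comment> \<open>The three kinds of rays of \<open>D\<close>, lowering \<open>w\<close>,
      lowering one \<open>y $ i\<close>, and raising \<open>w\<close> while lowering all of
      \<open>y\<close>, yield the three conditions of \<open>U_cone\<close>.\<close>
    have "0 \<le> u0"
    proof (rule nonneg_of_bounded_ray)
      fix t :: real assume "0 \<le> t"
      then show "u0 * w + u \<bullet> y - t * u0 < - \<beta>"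
        using D_lt[of "w - t" y] by (simp add: D_iff algebra_simps)
    qed
    moreover have "0 \<le> u $ i" for i
    proof (rule nonneg_of_bounded_ray)
      fix t :: real assume "0 \<le> t"
      then show "u0 * w + u \<bullet> y - t * u $ i < - \<beta>"
        using D_lt[of w "y - t *\<^sub>R indicator_vec {i}"] by (simp add: D_iff inner_diff_right inner_indicator_vec)
    qed
    moreover have "0 \<le> (\<Sum>i\<in>UNIV. u $ i) - u0"
    proof (rule nonneg_of_bounded_ray)
      fix t :: real assume "0 \<le> t"
      then show "u0 * w + u \<bullet> y - t * ((\<Sum>i\<in>UNIV. u $ i) - u0) < - \<beta>"
        using D_lt[of "w + t" "y - t *\<^sub>R indicator_vec UNIV"]
        by (simp add: D_iff inner_diff_right inner_indicator_vec algebra_simps)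
    qed
    ultimately have "(u0, u) \<in> U_cone" by (simp add: U_cone_def)
    then have le: "(\<Sum>k\<in>K. \<mu> k * F_agg h u0 u (v k)) \<le> u0 * w + u \<bullet> y" by (rule cone)
    \<comment> \<open>With the minimizing index at each chain point, the separating functional takes
      at \<open>pt j\<close> exactly the averaged value of \<open>F_agg\<close>, which
      \<open>cone\<close> bounds.\<close>
    have "\<exists>j. \<forall>k. F_agg h u0 u (v k) = u0 * h (j k) (v k) + (\<Sum>i\<in>UNIV. u $ i * gap h (j k) i (v k))"
      by (intro choice allI F_agg_attained)
    then obtain j where j: "\<And>k. F_agg h u0 u (v k) = u0 * h (j k) (v k) + (\<Sum>i\<in>UNIV. u $ i * gap h (j k) i (v k))"
      by blast
    have "pt (restrict j K) = pt j" unfolding pt_def by (intro sum.cong) auto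
    moreover have "pt (restrict j K) \<in> Q"
      unfolding Q_def by (intro hull_inc imageI) auto
    moreover have "(u0, u) \<bullet> pt j = (\<Sum>k\<in>K. \<mu> k * F_agg h u0 u (v k))"
      by (simp add: pt_def inner_sum_right j inner_vec_def distrib_left sum_distrib_left mult.left_commute)
    ultimately have "- \<beta> < (\<Sum>k\<in>K. \<mu> k * F_agg h u0 u (v k))"
      using Q_lt by metis
    moreover have "u0 * w + u \<bullet> y < - \<beta>" by (rule D_lt) (simp add: D_iff)
    ultimately show False using le by linarith
  qed
  then obtain p q where pq: "(p, q) \<in> Q" "(p, q) \<in> D" by auto
  \<comment> \<open>The translation by the recession vector \<open>(w - p, y - q)\<close> carries
    \<open>(p, q)\<close> to \<open>(w, y)\<close>; since \<open>G\<close> is convex, only the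
    generators of \<open>Q\<close> need checking.\<close>
  define G where "G = {z. (fst z + (w - p), snd z + (y - q), x) \<in> convex hull (P_H X h)}"
  have "convex G"
  proof (rule convexI)
    fix z z' :: "real \<times> (real ^ 'n)" and s t :: real
    assume zz: "z \<in> G" "z' \<in> G" and st: "0 \<le> s" "0 \<le> t" "s + t = 1"
    have "s *\<^sub>R (fst z + (w - p), snd z + (y - q), x) + t *\<^sub>R (fst z' + (w - p), snd z' + (y - q), x)
      \<in> convex hull (P_H X h)"
      using zz st by (intro convexD convex_convex_hull) (auto simp: G_def)
    moreover have "s *\<^sub>R (fst z + (w - p), snd z + (y - q), x) + t *\<^sub>R (fst z' + (w - p), snd z' + (y - q), x)
      = (fst (s *\<^sub>R z + t *\<^sub>R z') + (s + t) *\<^sub>R (w - p), snd (s *\<^sub>R z + t *\<^sub>R z') + (s + t) *\<^sub>R (y - q), (s + t) *\<^sub>R x)"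
      by (simp add: algebra_simps)
    ultimately show "s *\<^sub>R z + t *\<^sub>R z' \<in> G" by (simp add: G_def st(3))
  qed
  moreover have "pt j \<in> G" for j
  proof -
    have "(h (j k) (v k) + (w - p), (\<chi> i. gap h (j k) i (v k)) + (y - q), v k) \<in> P_H X h" if "k \<in> K" for k
    proof -
      have "0 \<le> gap h (j k) i (v k) + (y $ i - q $ i)" for i
        using pq(2) by (intro add_nonneg_nonneg) (auto simp: D_iff gap_def)
      moreover have "h i (v k) - (gap h (j k) i (v k) + (y $ i - q $ i)) \<le> h (j k) (v k) + (w - p)" for i
      proof -
        have "h i (v k) - h (j k) (v k) \<le> gap h (j k) i (v k)" by (simp add: gap_def)
        moreover have "p + q $ i \<le> w + y $ i" using pq(2) by (simp add: D_iff)
        ultimately show ?thesis by linarith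
      qed
      ultimately show ?thesis using v(1)[OF that] by (simp add: P_H_def)
    qed
    then have "(\<Sum>k\<in>K. \<mu> k *\<^sub>R (h (j k) (v k) + (w - p), (\<chi> i. gap h (j k) i (v k)) + (y - q), v k))
        \<in> convex hull (P_H X h)"
      using \<mu> by (intro convex_sum[OF K convex_convex_hull]) (auto intro: hull_inc)
    moreover have "(\<Sum>k\<in>K. \<mu> k *\<^sub>R (h (j k) (v k) + (w - p), (\<chi> i. gap h (j k) i (v k)) + (y - q), v k))
      = (fst (pt j) + (\<Sum>k\<in>K. \<mu> k) *\<^sub>R (w - p), snd (pt j) + (\<Sum>k\<in>K. \<mu> k) *\<^sub>R (y - q), x)"
      unfolding pt_def v(2)[symmetric]
      by (simp add: prod_eq_iff fst_sum snd_sum scaleR_add_right distrib_left sum.distrib scaleR_sum_left sum_distrib_right)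
    ultimately show ?thesis by (simp add: G_def \<mu>(2))
  qed
  ultimately have "Q \<subseteq> G" unfolding Q_def by (intro hull_minimal) auto
  then show ?thesis using pq(1) by (auto simp: G_def)
qed

theorem proposition5p23:
  fixes a b :: "'n::finite \<Rightarrow> ereal"
    and h :: "'n \<Rightarrow> real ^ 'n \<Rightarrow> real"
  assumes "integer_bounds a b"
    and "\<And>j. L_natural_convex_on (discrete_box a b) (h j)"
    and "\<And>i j. L_natural_convex_on (discrete_box a b) (gap h j i)"
    and "\<And>u0 u. (u0, u) \<in> U_cone \<Longrightarrow> L_natural_convex_on (discrete_box a b) (F_agg h u0 u)"
  shows "convex hull (P_H (discrete_box a b) h) = CP_fin a b h"
proof
  show "convex hull (P_H (discrete_box a b) h) \<subseteq> CP_fin a b h"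
    by (rule hull_minimal) (rule P_H_subset_CP_fin, rule convex_CP_fin)
  show "CP_fin a b h \<subseteq> convex hull (P_H (discrete_box a b) h)"
  proof
    fix z assume "z \<in> CP_fin a b h"
    then obtain w y x where z: "z = (w, y, x)" and y: "\<And>i. 0 \<le> y $ i" and x: "x \<in> relaxed_box a b"
      and conv: "\<And>u. u \<in> U_fin \<Longrightarrow>
        (w + u \<bullet> y, x) \<in> convex hull (epigraph_on (discrete_box a b) (F_agg h 1 u))"
      by (auto simp: CP_fin_def)
    show "z \<in> convex hull (P_H (discrete_box a b) h)"
    \<comment> \<open>The chain is fixed before any \<open>u\<close> is considered: it turns the
      hull constraints into sums, and the same points and weights then build \<open>z\<close> from
      \<open>P_H\<close>.\<close>
    proof (rule common_chain[OF assms(1) x])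
      fix m :: nat and v :: "nat \<Rightarrow> real ^ 'n" and \<mu> :: "nat \<Rightarrow> real"
      assume chain: "\<And>k. k \<le> m \<Longrightarrow> v k \<in> discrete_box a b" "\<And>k. k \<le> m \<Longrightarrow> 0 \<le> \<mu> k"
        "(\<Sum>k\<le>m. \<mu> k) = 1" "(\<Sum>k\<le>m. \<mu> k *\<^sub>R v k) = x"
        and le: "\<And>f \<eta>. L_natural_convex_on (discrete_box a b) f \<Longrightarrow>
          (\<eta>, x) \<in> convex hull (epigraph_on (discrete_box a b) f) \<Longrightarrow> (\<Sum>k\<le>m. \<mu> k * f (v k)) \<le> \<eta>"
      have "(\<Sum>k\<le>m. \<mu> k * F_agg h 1 u (v k)) \<le> w + u \<bullet> y" if "u \<in> U_fin" for u
      proof (rule le[OF assms(4) conv[OF that]])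
        show "(1, u) \<in> U_cone"
          using that by (simp add: U_cone_def U_fin_nonneg one_le_sum_of_U_fin)
      qed
      then have "(\<Sum>k\<le>m. \<mu> k * F_agg h u0 u (v k)) \<le> u0 * w + u \<bullet> y" if "(u0, u) \<in> U_cone" for u0 u
        using chain(2) y that by (intro weighted_F_agg_le_cone) auto
      then show ?thesis
        unfolding z using chain by (intro mem_convex_hull_P_H[of "{..m}" \<mu> v]) auto
    qed
  qed
qed

end
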